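(* Let $\mathbf X$ be a zero-mean Gaussian random vector in $\mathbb R^n$ with a nonsingular covariance matrix $\Sigma$, let $w\colon\mathbb R^n\to[0,\infty)$ be an even unimodal function with $\mathsf E\,w(\mathbf X)>0$, and let $\mathbf u\in\mathbb R^n$ be a unit vector. Then for any real $t\ge0$ $$e^{-t^2\langle\mathbf u,\Sigma^{-1}\mathbf u\rangle/2}=r_{t\|\Sigma^{-1/2}\mathbf u\|}(0)\le\frac{\mathsf E\,w(\mathbf X-t\mathbf u)}{\mathsf E\,w(\mathbf X)}\le r_{t\|\Sigma^{-1/2}\mathbf u\|}(a_{\Sigma,w,\mathbf u})\le1,$$ where $$a_{\Sigma,w,\mathbf u}:=\frac{\delta^*(\Sigma^{-1}\mathbf u\,|\,A_w)}{\|\Sigma^{-1/2}\mathbf u\|}\in[0,\infty],\qquad A_w:=\{\mathbf x\in\mathbb R^n\colon w(\mathbf x)>0\}.$$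
   Context: $\langle\cdot,\cdot\rangle$ and $\|\cdot\|$ are the standard inner product and the Euclidean norm on $\mathbb R^n$; $\Sigma^{-1/2}$ is the inverse of the symmetric positive-definite square root of $\Sigma$. A function $w\colon\mathbb R^n\to[0,\infty)$ is even if $w(-\mathbf x)=w(\mathbf x)$ for all $\mathbf x$, and unimodal if the set $\{\mathbf x\in\mathbb R^n\colon w(\mathbf x)>c\}$ is convex for each real $c$. (Convex sets are Lebesgue measurable; expectations are integrals against the Gaussian density with respect to Lebesgue measure.) The support function of a set $A\subseteq\mathbb R^n$ is $\delta^*(\mathbf v|A):=\sup\{\langle\mathbf z,\mathbf v\rangle\colon\mathbf z\in A\}$ for $\mathbf v\in\mathbb R^n$. $\Phi$ is the standard normal cumulative distribution function on $\mathbb R$. For $t\in[0,\infty)$ and $a\in[0,\infty]$, $r_t(a):=e^{-t^2/2}$ if $a=0$; $r_t(a):=\dfrac{\Phi(t+a)-\Phi(t-a)}{\Phi(a)-\Phi(-a)}$ if $a\in(0,\infty)$; $r_t(a):=1$ if $a=\infty$. *)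

theory Defs
  imports "HOL-Probability.Probability"
begin

definition standard_gaussian :: "(real ^ 'n) measure" where
  "standard_gaussian = density lborel (\<lambda>z. ennreal (\<Prod>i\<in>UNIV. std_normal_density (z $ i)))"

(* Affine image of a standard normal vector, the matrix A being allowed to be singular.
   Mean and covariance matrix are not parameters here: they are computed from X below. *)
definition gaussian_vector :: "'s measure \<Rightarrow> ('s \<Rightarrow> real ^ 'n) \<Rightarrow> bool" where
  "gaussian_vector M X \<longleftrightarrow> prob_space M \<and> X \<in> borel_measurable M \<and>
     (\<exists>(m :: real ^ 'n) (A :: real ^ 'n ^ 'n).
        distr M borel X = distr standard_gaussian borel (\<lambda>z. m + A *v z))"

definition mean_vector :: "'s measure \<Rightarrow> ('s \<Rightarrow> real ^ 'n) \<Rightarrow> real ^ 'n" where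
  "mean_vector M X = integral\<^sup>L M X"

definition covariance_matrix :: "'s measure \<Rightarrow> ('s \<Rightarrow> real ^ 'n) \<Rightarrow> real ^ 'n ^ 'n" where
  "covariance_matrix M X =
     (\<chi> i j. \<integral>\<omega>. (X \<omega> $ i - mean_vector M X $ i) * (X \<omega> $ j - mean_vector M X $ j) \<partial>M)"

(* A unimodal w is Lebesgue measurable but in general not Borel measurable, so w(X) need not be
   measurable with respect to M itself.  It is measurable with respect to the completion of M
   whenever the law of X is absolutely continuous, and its integral is then the Lebesgue integral
   of w against the density of X.  On M-measurable functions this is the usual expectation. *)
definition expect :: "'s measure \<Rightarrow> ('s \<Rightarrow> real) \<Rightarrow> real" where
  "expect M Y = integral\<^sup>L (completion M) Y"

definition posdef :: "real ^ 'n ^ 'n \<Rightarrow> bool" where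
  "posdef B \<longleftrightarrow> transpose B = B \<and> (\<forall>x. x \<noteq> 0 \<longrightarrow> 0 < x \<bullet> (B *v x))"

definition matrix_sqrt :: "real ^ 'n ^ 'n \<Rightarrow> real ^ 'n ^ 'n" where
  "matrix_sqrt S = (THE B. posdef B \<and> B ** B = S)"

definition even_fun :: "(real ^ 'n \<Rightarrow> real) \<Rightarrow> bool" where
  "even_fun w \<longleftrightarrow> (\<forall>x. w (- x) = w x)"

definition unimodal :: "(real ^ 'n \<Rightarrow> real) \<Rightarrow> bool" where
  "unimodal w \<longleftrightarrow> (\<forall>c. convex {x. w x > c})"

definition support_function :: "(real ^ 'n) set \<Rightarrow> real ^ 'n \<Rightarrow> ereal" where
  "support_function A v = (SUP z\<in>A. ereal (z \<bullet> v))"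

definition Phi :: "real \<Rightarrow> real" where
  "Phi = cdf std_normal_distribution"

(* Only meant for t and a nonnegative. *)
definition r :: "real \<Rightarrow> ereal \<Rightarrow> real" where
  "r t a =
     (if a = 0 then exp (- (t\<^sup>2) / 2)
      else if a = \<infinity> then 1
      else (Phi (t + real_of_ereal a) - Phi (t - real_of_ereal a)) /
           (Phi (real_of_ereal a) - Phi (- real_of_ereal a)))"

definition positivity_set :: "(real ^ 'n \<Rightarrow> real) \<Rightarrow> (real ^ 'n) set" where
  "positivity_set w = {x. w x > 0}"

definition a_coeff :: "real ^ 'n ^ 'n \<Rightarrow> (real ^ 'n \<Rightarrow> real) \<Rightarrow> real ^ 'n \<Rightarrow> ereal" where
  "a_coeff S w u =
     support_function (positivity_set w) (matrix_inv S *v u) /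
     ereal (norm (matrix_inv (matrix_sqrt S) *v u))"

end

theory Submission
  imports Defs
begin

text \<open>
  Write the vector as \<open>X = A Z\<close> with \<open>Z\<close> standard Gaussian, \<open>\<Sigma> = A A\<^sup>T\<close>, and rotate \<open>Z\<close> so that
  \<open>u = A (\<sigma> b)\<close> for a coordinate vector \<open>b\<close>; then \<open>\<sigma> = \<parallel>\<Sigma>\<^sup>-\<^sup>1\<^sup>/\<^sup>2 u\<parallel>\<close>, and shifting \<open>X\<close> by \<open>t u\<close> means
  shifting \<open>Z\<close> by \<open>c b\<close> with \<open>c = t \<sigma>\<close>. The function \<open>w \<circ> A\<close> is again even and unimodal. It is the
  superposition of the indicators of its level sets (\<open>nn_integral_layer_cake\<close>), each of which is
  convex and symmetric, and differs from its interior \<open>K\<close> by a null set. So everything reduces to a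
  symmetric convex Borel set \<open>K\<close> (\<open>gaussian_shift_symmetric_convex\<close>).

  Completing the square in the Gaussian density and averaging over \<open>z \<mapsto> - z\<close> gives
  \<open>P (Z - c b \<in> K) = exp (- c\<^sup>2 / 2) E (1\<^sub>K(Z) cosh (c (Z \<bullet> b)))\<close>. The lower bound is \<open>cosh \<ge> 1\<close>. For
  the upper bound, integrating \<open>1\<^sub>K\<close> over all coordinates other than that of \<open>b\<close> leaves an even
  log-concave function \<open>g\<close> of \<open>s = Z \<bullet> b\<close>, because log-concavity survives the integration over one
  coordinate (\<open>log_concave_gauss_marginal\<close>, a consequence of the one-dimensional
  Prekopa--Leindler inequality \<open>Prekopa_Leindler_real\<close>). Hence \<open>g\<close> decreases in \<open>\<bar>s\<bar>\<close> while
  \<open>cosh (c s)\<close> increases, and Chebyshev's correlation inequality on a slab \<open>\<bar>s\<bar> \<le> a\<close> containing \<open>K\<close>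
  bounds the mean of \<open>cosh (c s)\<close> under the weight \<open>g\<close> by its mean over the slab. That mean,
  times \<open>exp (- c\<^sup>2 / 2)\<close>, is the quotient of the Gaussian measures of the shifted and of the original
  slab, which is the function \<open>r\<close> of the theorem.

  The identification of \<open>\<sigma>\<close> needs the positive definite square root of \<open>A A\<^sup>T\<close>. It is obtained
  without spectral theory as \<open>A Q\<close>, where \<open>Q\<close> maximises the trace of \<open>A Q\<close> over the orthogonal
  matrices (\<open>posdef_square_root_exists\<close>).
\<close>

section \<open>The layer cake formula and the one-dimensional Prekopa--Leindler inequality\<close>

lemma borel_measurable_upper_tail:
  fixes f :: "'a \<Rightarrow> real"
  assumes M: "sigma_finite_measure M" and [measurable]: "f \<in> borel_measurable M"
  shows "(\<lambda>s. emeasure M {x \<in> space M. s < f x}) \<in> borel_measurable borel"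
proof -
  interpret M: sigma_finite_measure M by fact
  have "(\<lambda>s. \<integral>\<^sup>+x. indicator {p. fst p < f (snd p)} (s, x) \<partial>M) \<in> borel_measurable borel"
    by measurable
  also have "(\<lambda>s. \<integral>\<^sup>+x. indicator {p. fst p < f (snd p)} (s, x) \<partial>M)
      = (\<lambda>s. \<integral>\<^sup>+x. indicator {x \<in> space M. s < f x} x \<partial>M)"
    by (intro ext nn_integral_cong) (auto simp: indicator_def)
  also have "\<dots> = (\<lambda>s. emeasure M {x \<in> space M. s < f x})" by simp
  finally show ?thesis .
qed

text \<open>
  Fubini, applied to the region between the graph of \<open>f\<close> and the zero level. The level \<open>0\<close> is
  left out so that later only levels \<open>s > 0\<close> matter, on which the level sets of a Gaussian
  density are bounded.
\<close>

lemma nn_integral_layer_cake: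
  assumes M: "sigma_finite_measure M" and [measurable]: "f \<in> borel_measurable M"
    and nn: "\<And>x. 0 \<le> f x"
  shows "(\<integral>\<^sup>+x. ennreal (f x) \<partial>M)
       = (\<integral>\<^sup>+s. emeasure M {x \<in> space M. s < f x} * indicator {0<..} s \<partial>lborel)"
proof -
  interpret M: sigma_finite_measure M by fact
  interpret pair_sigma_finite M lborel by standard
  have [measurable]: "Measurable.pred (M \<Otimes>\<^sub>M lborel) (\<lambda>p. 0 < snd p \<and> snd p < f (fst p))"
    by measurable
  have "(\<integral>\<^sup>+x. ennreal (f x) \<partial>M) = (\<integral>\<^sup>+x. \<integral>\<^sup>+s. indicator {0<..<f x} s \<partial>lborel \<partial>M)"
    using nn by (intro nn_integral_cong) (simp add: nn_integral_indicator)
  also have "\<dots> = (\<integral>\<^sup>+x. \<integral>\<^sup>+s. indicator {p. 0 < snd p \<and> snd p < f (fst p)} (x, s) \<partial>lborel \<partial>M)"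
    by (intro nn_integral_cong) (auto simp: indicator_def)
  also have "\<dots> = (\<integral>\<^sup>+s. \<integral>\<^sup>+x. indicator {p. 0 < snd p \<and> snd p < f (fst p)} (x, s) \<partial>M \<partial>lborel)"
    by (rule Fubini'[symmetric]) (simp add: split_beta')
  also have "\<dots> = (\<integral>\<^sup>+s. \<integral>\<^sup>+x. indicator {x \<in> space M. s < f x} x * indicator {0<..} s \<partial>M \<partial>lborel)"
    by (intro nn_integral_cong) (auto simp: indicator_def)
  also have "\<dots> = (\<integral>\<^sup>+s. emeasure M {x \<in> space M. s < f x} * indicator {0<..} s \<partial>lborel)"
    by (intro nn_integral_cong) (simp add: nn_integral_multc)
  finally show ?thesis .
qed

text \<open>
  Convex subsets of the line are intervals, and the combination of two intervals is the
  interval between the combinations of their end points. As an end point need not belong to the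
  interval, only the open interval between the combined end points is shown to lie in \<open>C\<close>.
\<close>

lemma Minkowski_sum_interval_measure:
  fixes A B C :: "real set"
  assumes A: "convex A" "A \<noteq> {}" "bounded A" and B: "convex B" "B \<noteq> {}" "bounded B"
    and l: "0 \<le> l" "l \<le> 1" and C: "C \<in> sets borel"
    and sub: "\<And>x y. x \<in> A \<Longrightarrow> y \<in> B \<Longrightarrow> (1 - l) * x + l * y \<in> C"
  shows "ennreal (1 - l) * emeasure lborel A + ennreal l * emeasure lborel B \<le> emeasure lborel C"
proof -
  have bd: "bdd_below A" "bdd_above A" "bdd_below B" "bdd_above B"
    using A B by (auto simp: bounded_imp_bdd_below bounded_imp_bdd_above)
  define a1 a2 b1 b2 where ab: "a1 = Inf A" "a2 = Sup A" "b1 = Inf B" "b2 = Sup B"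
  have le: "a1 \<le> a2" "b1 \<le> b2" unfolding ab using A B bd by (auto intro: cInf_le_cSup)
  have "A \<subseteq> {a1..a2}" "B \<subseteq> {b1..b2}" unfolding ab using bd by (auto intro: cInf_lower cSup_upper)
  then have mA: "emeasure lborel A \<le> ennreal (a2 - a1)" and mB: "emeasure lborel B \<le> ennreal (b2 - b1)"
    using le emeasure_mono[of A "{a1..a2}" lborel] emeasure_mono[of B "{b1..b2}" lborel] by auto
  define c1 c2 where c: "c1 = (1 - l) * a1 + l * b1" "c2 = (1 - l) * a2 + l * b2"
  have iv: "t \<in> S" if "convex S" "p \<in> S" "q \<in> S" "p \<le> t" "t \<le> q" for S :: "real set" and p q t
    using that mem_is_interval_1_I is_interval_convex_1 by blast
  have "{c1<..<c2} \<subseteq> C"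
  proof
    fix s assume s: "s \<in> {c1<..<c2}"
    define e where "e = min (s - c1) (c2 - s)"
    have e: "e > 0" using s by (auto simp: e_def)
    obtain p where p: "p \<in> A" "p < a1 + e" using cInf_lessD[of A "a1 + e"] A e by (auto simp: ab)
    obtain q where q: "q \<in> A" "a2 - e < q" using less_cSupD[of A "a2 - e"] A e by (auto simp: ab)
    obtain p' where p': "p' \<in> B" "p' < b1 + e" using cInf_lessD[of B "b1 + e"] B e by (auto simp: ab)
    obtain q' where q': "q' \<in> B" "b2 - e < q'" using less_cSupD[of B "b2 - e"] B e by (auto simp: ab)
    define x y where xy: "x = (1 - l) * p + l * p'" "y = (1 - l) * q + l * q'"
    have "x \<le> (1 - l) * (a1 + e) + l * (b1 + e)" unfolding xy
      using p p' l by (intro add_mono mult_left_mono) auto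
    also have "\<dots> = c1 + e" by (simp add: c algebra_simps)
    also have "\<dots> \<le> s" by (simp add: e_def)
    finally have xs: "x \<le> s" .
    have "s \<le> c2 - e" by (simp add: e_def)
    also have "c2 - e = (1 - l) * (a2 - e) + l * (b2 - e)" by (simp add: c algebra_simps)
    also have "\<dots> \<le> y" unfolding xy
      using q q' l by (intro add_mono mult_left_mono) auto
    finally have sy: "s \<le> y" .
    define C' where "C' = (\<lambda>(x, y). (1 - l) * x + l * y) ` (A \<times> B)"
    have "convex C'" unfolding C'_def
      by (intro convex_linear_image convex_Times A B linearI)
         (auto simp: algebra_simps)
    moreover have "x \<in> C'" "y \<in> C'" using p p' q q' by (force simp: C'_def xy)+
    ultimately have "s \<in> C'" using iv xs sy by blast
    then show "s \<in> C" using sub by (auto simp: C'_def)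
  qed
  then have "emeasure lborel {c1<..<c2} \<le> emeasure lborel C"
    using C by (intro emeasure_mono) auto
  moreover have "c1 \<le> c2" unfolding c using le l by (intro add_mono mult_left_mono) auto
  ultimately have "ennreal (c2 - c1) \<le> emeasure lborel C" by simp
  moreover have "ennreal (1 - l) * emeasure lborel A + ennreal l * emeasure lborel B
     \<le> ennreal (1 - l) * ennreal (a2 - a1) + ennreal l * ennreal (b2 - b1)"
    by (intro add_mono mult_left_mono mA mB) auto
  moreover have "\<dots> = ennreal ((1 - l) * (a2 - a1) + l * (b2 - b1))"
    using l le by (simp add: ennreal_mult)
  moreover have "(1 - l) * (a2 - a1) + l * (b2 - b1) = c2 - c1" by (simp add: c algebra_simps)
  ultimately show ?thesis by simp
qed

text \<open>
  After division of \<open>f\<close> and \<open>g\<close> by their suprema \<open>F\<close> and \<open>G\<close>, and of \<open>h\<close> by the corresponding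
  geometric mean \<open>\<theta>\<close>, the level sets of \<open>f\<close> and \<open>g\<close> are nonempty at the same levels, those below 1,
  and the level set of \<open>h\<close> contains their combination. Adding the lengths over all levels gives
  the inequality with the arithmetic mean of the normalised integrals, which is stronger than the
  one with the geometric mean. The level sets are assumed convex, so that the comparison of lengths
  needs only intervals.
\<close>

lemma Prekopa_Leindler_real:
  fixes f g h :: "real \<Rightarrow> real"
  assumes int: "integrable lborel f" "integrable lborel g" "integrable lborel h"
    and nn: "\<And>x. 0 \<le> f x" "\<And>x. 0 \<le> g x" "\<And>x. 0 \<le> h x"
    and bdd: "bdd_above (range f)" "bdd_above (range g)"
    and cvx: "\<And>c. 0 < c \<Longrightarrow> convex {x. c < f x}" "\<And>c. 0 < c \<Longrightarrow> convex {x. c < g x}"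
    and bnd: "\<And>c. 0 < c \<Longrightarrow> bounded {x. c < f x}" "\<And>c. 0 < c \<Longrightarrow> bounded {x. c < g x}"
    and l: "0 \<le> l" "l \<le> 1"
    and h: "\<And>x y. f x powr (1 - l) * g y powr l \<le> h ((1 - l) * x + l * y)"
  shows "(\<integral>x. f x \<partial>lborel) powr (1 - l) * (\<integral>x. g x \<partial>lborel) powr l \<le> (\<integral>x. h x \<partial>lborel)"
proof -
  have [measurable]: "f \<in> borel_measurable borel" "g \<in> borel_measurable borel" "h \<in> borel_measurable borel"
    using int by auto
  define If Ig Ih where I: "If = (\<integral>x. f x \<partial>lborel)" "Ig = (\<integral>x. g x \<partial>lborel)" "Ih = (\<integral>x. h x \<partial>lborel)"
  have Inn: "If \<ge> 0" "Ig \<ge> 0" "Ih \<ge> 0" unfolding I using nn by (auto intro: integral_nonneg)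
  show ?thesis
  proof (cases "If = 0 \<or> Ig = 0")
    case True
    then show ?thesis using Inn unfolding I[symmetric] by auto
  next
    case False
    then have Ipos: "If > 0" "Ig > 0" using Inn by auto
    have "\<exists>x. f x > 0"
    proof (rule ccontr)
      assume "\<not> ?thesis"
      then have "f = (\<lambda>_. 0)" using nn(1) by (auto simp: fun_eq_iff not_less intro: antisym)
      then show False using Ipos(1) by (simp add: I)
    qed
    then obtain x0 where x0: "f x0 > 0" by auto
    have "\<exists>x. g x > 0"
    proof (rule ccontr)
      assume "\<not> ?thesis"
      then have "g = (\<lambda>_. 0)" using nn(2) by (auto simp: fun_eq_iff not_less intro: antisym)
      then show False using Ipos(2) by (simp add: I)
    qed
    then obtain y0 where y0: "g y0 > 0" by auto
    define F G where FG: "F = Sup (range f)" "G = Sup (range g)"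
    have fF: "f x \<le> F" and gG: "g x \<le> G" for x
      unfolding FG using bdd by (auto intro: cSup_upper)
    have pos: "F > 0" "G > 0" using x0 y0 fF[of x0] gG[of y0] by auto
    define \<theta> where "\<theta> = F powr (1 - l) * G powr l"
    have \<theta>: "\<theta> > 0" using pos by (simp add: \<theta>_def)
    define \<mu> where "\<mu> = (emeasure lborel :: real set \<Rightarrow> ennreal)"
    have key: "ennreal (1 - l) * \<mu> {x. s < f x / F} + ennreal l * \<mu> {x. s < g x / G} \<le> \<mu> {x. s < h x / \<theta>}"
      if s: "0 < s" for s
    proof (cases "s < 1")
      case True
      have eqs: "{x. s < f x / F} = {x. s * F < f x}" "{x. s < g x / G} = {x. s * G < g x}"
        "{x. s < h x / \<theta>} = {x. s * \<theta> < h x}"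
        using pos \<theta> by (auto simp: field_simps)
      have "s * F < F" "s * G < G" using True pos by auto
      then have ne: "{x. s * F < f x} \<noteq> {}" "{x. s * G < g x} \<noteq> {}"
        using less_cSupD[of "range f" "s * F"] less_cSupD[of "range g" "s * G"] by (auto simp: FG)
      show ?thesis unfolding \<mu>_def eqs
      proof (rule Minkowski_sum_interval_measure)
        fix x y assume xy: "x \<in> {x. s * F < f x}" "y \<in> {x. s * G < g x}"
        \<comment> \<open>Passing through the minimum keeps the inequality strict also for \<open>l = 0\<close> and \<open>l = 1\<close>.\<close>
        define m where "m = min (f x / F) (g y / G)"
        have m: "s < m" using xy pos by (auto simp: m_def field_simps)
        have "s * \<theta> < m * \<theta>" using m \<theta> by simp
        also have "m * \<theta> = (m powr (1 - l) * m powr l) * \<theta>"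
          using m s by (simp add: powr_add[symmetric])
        also have "\<dots> = (m * F) powr (1 - l) * (m * G) powr l"
          using m s pos by (simp add: powr_mult \<theta>_def)
        also have "\<dots> \<le> f x powr (1 - l) * g y powr l"
        proof (intro mult_mono powr_mono2)
          have "m \<le> f x / F" "m \<le> g y / G" by (simp_all add: m_def)
          then show "m * F \<le> f x" "m * G \<le> g y" using pos by (simp_all add: field_simps)
        qed (use l m s pos in auto)
        also have "\<dots> \<le> h ((1 - l) * x + l * y)" by (rule h)
        finally show "(1 - l) * x + l * y \<in> {x. s * \<theta> < h x}" by simp
      qed (use s pos ne l cvx bnd in auto)
    next
      case False
      have le: "f x / F \<le> 1" "g x / G \<le> 1" for x using fF[of x] gG[of x] pos by (auto simp: field_simps)
      have "{x. s < f x / F} = {}" "{x. s < g x / G} = {}"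
        using le False by (auto simp: not_less intro: order_trans)
      then show ?thesis by (simp add: \<mu>_def)
    qed
    have lc: "(\<integral>\<^sup>+x. ennreal (k x) \<partial>lborel) = (\<integral>\<^sup>+s. \<mu> {x. s < k x} * indicator {0<..} s \<partial>lborel)"
      and lcm: "(\<lambda>s. \<mu> {x. s < k x} * indicator {0<..} s) \<in> borel_measurable borel"
      if [measurable]: "k \<in> borel_measurable borel" and "\<And>x. 0 \<le> k x" for k :: "real \<Rightarrow> real"
    proof -
      show "(\<integral>\<^sup>+x. ennreal (k x) \<partial>lborel) = (\<integral>\<^sup>+s. \<mu> {x. s < k x} * indicator {0<..} s \<partial>lborel)"
        using nn_integral_layer_cake[OF sigma_finite_lborel, of k] that by (simp add: \<mu>_def)
      have "(\<lambda>s. \<mu> {x. s < k x}) \<in> borel_measurable borel"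
        using borel_measurable_upper_tail[OF sigma_finite_lborel, of k] by (simp add: \<mu>_def)
      then show "(\<lambda>s. \<mu> {x. s < k x} * indicator {0<..} s) \<in> borel_measurable borel" by simp
    qed
    have nnI: "(\<integral>\<^sup>+x. ennreal (f x / F) \<partial>lborel) = ennreal (If / F)"
      "(\<integral>\<^sup>+x. ennreal (g x / G) \<partial>lborel) = ennreal (Ig / G)"
      "(\<integral>\<^sup>+x. ennreal (h x / \<theta>) \<partial>lborel) = ennreal (Ih / \<theta>)"
      using int nn pos \<theta> by (subst nn_integral_eq_integral; auto simp: I)+
    have m: "(\<lambda>s. \<mu> {x. s < f x / F} * indicator {0<..} s) \<in> borel_measurable lborel"
      "(\<lambda>s. \<mu> {x. s < g x / G} * indicator {0<..} s) \<in> borel_measurable lborel"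
      using lcm[of "\<lambda>x. f x / F"] lcm[of "\<lambda>x. g x / G"] nn pos by auto
    have "ennreal ((1 - l) * (If / F) + l * (Ig / G)) = ennreal (1 - l) * ennreal (If / F) + ennreal l * ennreal (Ig / G)"
      using l Inn pos by (simp add: ennreal_mult del: times_divide_eq_right)
    also have "\<dots> = (\<integral>\<^sup>+s. ennreal (1 - l) * (\<mu> {x. s < f x / F} * indicator {0<..} s)
        + ennreal l * (\<mu> {x. s < g x / G} * indicator {0<..} s) \<partial>lborel)"
      using lc[of "\<lambda>x. f x / F"] lc[of "\<lambda>x. g x / G"] nn pos m
      by (simp add: nnI[symmetric] nn_integral_add nn_integral_cmult)
    also have "\<dots> \<le> (\<integral>\<^sup>+s. \<mu> {x. s < h x / \<theta>} * indicator {0<..} s \<partial>lborel)"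
      using key by (intro nn_integral_mono) (auto simp: indicator_def)
    also have "\<dots> = ennreal (Ih / \<theta>)"
      unfolding nnI[symmetric] using nn \<theta> by (subst lc) auto
    finally have le: "(1 - l) * (If / F) + l * (Ig / G) \<le> Ih / \<theta>"
      using Inn \<theta> by (subst (asm) ennreal_le_iff) auto
    have "(If / F) powr (1 - l) * (Ig / G) powr l \<le> (1 - l) * (If / F) + l * (Ig / G)"
      using l Ipos pos by (intro Youngs_inequality_0) auto
    also note le
    also have "(If / F) powr (1 - l) * (Ig / G) powr l = (If powr (1 - l) * Ig powr l) / \<theta>"
      using Ipos pos by (simp add: powr_divide \<theta>_def)
    finally show ?thesis using \<theta> by (simp add: I divide_le_cancel)
  qed
qed

section \<open>Log-concave functions and their Gaussian marginals\<close>

text \<open>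
  Since \<open>0 powr p = 0\<close> for every \<open>p\<close>, including \<open>p = 0\<close>, the inequality is vacuous whenever \<open>f\<close>
  vanishes at one of the two points, as it should be for functions such as the indicator of a
  convex set.
\<close>

definition log_concave :: "('a::real_vector \<Rightarrow> real) \<Rightarrow> bool" where
  "log_concave f \<longleftrightarrow> (\<forall>x. 0 \<le> f x) \<and>
     (\<forall>x y l. 0 \<le> l \<longrightarrow> l \<le> 1 \<longrightarrow>
        f x powr (1 - l) * f y powr l \<le> f ((1 - l) *\<^sub>R x + l *\<^sub>R y))"

lemma log_concaveD:
  assumes "log_concave f"
  shows "0 \<le> f x"
    and "0 \<le> l \<Longrightarrow> l \<le> 1 \<Longrightarrow> f x powr (1 - l) * f y powr l \<le> f ((1 - l) *\<^sub>R x + l *\<^sub>R y)"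
  using assms by (auto simp: log_concave_def)

lemma log_concave_ge_min:
  assumes f: "log_concave f" and l: "0 \<le> l" "l \<le> 1"
  shows "min (f x) (f y) \<le> f ((1 - l) *\<^sub>R x + l *\<^sub>R y)"
proof -
  define m where "m = min (f x) (f y)"
  have m: "0 \<le> m" "m \<le> f x" "m \<le> f y" using log_concaveD(1)[OF f] by (auto simp: m_def)
  have "m = m powr (1 - l) * m powr l" using m by (cases "m = 0") (simp_all add: powr_add[symmetric])
  also have "\<dots> \<le> f x powr (1 - l) * f y powr l"
    using m l by (intro mult_mono powr_mono2) auto
  also have "\<dots> \<le> f ((1 - l) *\<^sub>R x + l *\<^sub>R y)" using log_concaveD(2)[OF f] l by auto
  finally show ?thesis by (simp add: m_def)
qed

lemma log_concave_imp_convex_superlevel: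
  assumes f: "log_concave f" shows "convex {x. c < f x}"
proof (rule convexI)
  fix x y and u v :: real
  assume *: "x \<in> {x. c < f x}" "y \<in> {x. c < f x}" "0 \<le> u" "0 \<le> v" "u + v = 1"
  then have u: "u = 1 - v" and "v \<le> 1" by auto
  then show "u *\<^sub>R x + v *\<^sub>R y \<in> {x. c < f x}"
    using log_concave_ge_min[OF f, of v x y] * by (auto simp: u min_def split: if_splits)
qed

lemma log_concave_std_normal_density: "log_concave std_normal_density"
  unfolding log_concave_def
proof (intro conjI allI impI)
  fix x y l :: real assume l: "0 \<le> l" "l \<le> 1"
  define C where "C = 1 / sqrt (2 * pi)"
  have C: "C > 0" by (simp add: C_def)
  have e: "std_normal_density z = C * exp (- z\<^sup>2 / 2)" for z
    by (simp add: std_normal_density_def C_def)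
  have pw: "(C * exp a) powr p = C powr p * exp (a * p)" for a p
    using C by (simp add: powr_def ln_mult exp_add[symmetric] algebra_simps)
  have "std_normal_density x powr (1 - l) * std_normal_density y powr l
      = (C powr (1 - l) * C powr l) * (exp (- x\<^sup>2 / 2 * (1 - l)) * exp (- y\<^sup>2 / 2 * l))"
    by (simp only: e pw) (simp only: ac_simps)
  also have "\<dots> = C * exp (- x\<^sup>2 / 2 * (1 - l) + - y\<^sup>2 / 2 * l)"
    using C by (simp add: powr_add[symmetric] exp_add[symmetric])
  also have "- x\<^sup>2 / 2 * (1 - l) + - y\<^sup>2 / 2 * l \<le> - ((1 - l) * x + l * y)\<^sup>2 / 2"
  proof -
    have "(1 - l) * x\<^sup>2 + l * y\<^sup>2 - ((1 - l) * x + l * y)\<^sup>2 = l * (1 - l) * (x - y)\<^sup>2" by algebra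
    moreover have "0 \<le> l * (1 - l) * (x - y)\<^sup>2" using l by simp
    ultimately show ?thesis by (simp add: field_simps)
  qed
  finally show "std_normal_density x powr (1 - l) * std_normal_density y powr l
      \<le> std_normal_density ((1 - l) *\<^sub>R x + l *\<^sub>R y)"
    using C by (simp add: e)
qed (simp add: normal_density_nonneg)

lemma std_normal_density_le_1: "std_normal_density x \<le> 1"
proof -
  have "sqrt (2 * pi) \<ge> 1" using pi_gt3 by (simp add: real_le_rsqrt)
  then have "1 / sqrt (2 * pi) \<le> 1" by simp
  moreover have "exp (- x\<^sup>2 / 2) \<le> 1" by simp
  ultimately show ?thesis unfolding std_normal_density_def by (intro mult_le_one) auto
qed

lemma bounded_superlevel_std_normal_density:
  assumes "0 < c" shows "bounded {x. c < std_normal_density x}"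
proof -
  have "norm x \<le> 1 + 2 / c" if "c < std_normal_density x" for x
  proof -
    have "sqrt (2 * pi) \<ge> 1" using pi_gt3 by (simp add: real_le_rsqrt)
    then have "1 / sqrt (2 * pi) \<le> 1" by simp
    then have "std_normal_density x \<le> 1 * exp (- x\<^sup>2 / 2)"
      unfolding std_normal_density_def by (intro mult_right_mono) auto
    with that have "c < exp (- x\<^sup>2 / 2)" by simp
    then have "c * exp (x\<^sup>2 / 2) < 1" by (simp add: exp_minus field_simps)
    moreover have "c * (1 + x\<^sup>2 / 2) \<le> c * exp (x\<^sup>2 / 2)"
      using assms by (intro mult_left_mono exp_ge_add_one_self) auto
    ultimately have "c * x\<^sup>2 < 2" using assms by (simp add: algebra_simps)
    then have "x\<^sup>2 < 2 / c" using assms by (simp add: field_simps)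
    moreover have "\<bar>x\<bar> \<le> 1 + x\<^sup>2"
      using zero_le_power2[of "\<bar>x\<bar> - 1"] by (simp add: power2_diff)
    ultimately show ?thesis by simp
  qed
  then show ?thesis by (auto simp: bounded_iff)
qed

abbreviation gauss1 :: "real measure" where "gauss1 \<equiv> std_normal_distribution"

lemma prob_space_gauss1: "prob_space gauss1"
  by (rule prob_space_normal_density) simp

text \<open>
  The coordinate of \<open>z\<close> along \<open>b\<close> is replaced by an independent normal variable. The result is
  kept as a function on the whole space, constant along \<open>b\<close>, so that the operation can be iterated
  over coordinates without changing the type.
\<close>

definition gauss_marginal :: "'a::euclidean_space \<Rightarrow> ('a \<Rightarrow> real) \<Rightarrow> 'a \<Rightarrow> real" where
  "gauss_marginal b f z = (\<integral>y. f (z + (y - z \<bullet> b) *\<^sub>R b) \<partial>gauss1)"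

lemma borel_measurable_gauss_marginal:
  assumes [measurable]: "f \<in> borel_measurable borel"
  shows "gauss_marginal b f \<in> borel_measurable borel"
proof -
  interpret prob_space gauss1 by (rule prob_space_gauss1)
  show ?thesis unfolding gauss_marginal_def by measurable
qed

lemma integrable_gauss1_bounded:
  fixes f :: "real \<Rightarrow> real"
  assumes "f \<in> borel_measurable borel" "\<And>x. 0 \<le> f x" "\<And>x. f x \<le> 1"
  shows "integrable gauss1 f"
proof -
  interpret prob_space gauss1 by (rule prob_space_gauss1)
  show ?thesis using assms by (intro integrable_const_bound[where B=1]) auto
qed

lemma gauss_marginal_range:
  assumes [measurable]: "f \<in> borel_measurable borel" and "\<And>x. 0 \<le> f x" "\<And>x. f x \<le> 1"
  shows "0 \<le> gauss_marginal b f z" "gauss_marginal b f z \<le> 1"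
proof -
  interpret prob_space gauss1 by (rule prob_space_gauss1)
  show "0 \<le> gauss_marginal b f z" unfolding gauss_marginal_def using assms(2) by (auto intro: integral_nonneg)
  have "gauss_marginal b f z \<le> (\<integral>y. 1 \<partial>gauss1)" unfolding gauss_marginal_def
    using assms by (intro integral_mono integrable_gauss1_bounded) auto
  then show "gauss_marginal b f z \<le> 1" using prob_space by simp
qed

text \<open>
  The three functions in the Prekopa--Leindler inequality are the restrictions of \<open>f\<close> to the lines
  through \<open>x\<close>, \<open>y\<close> and their convex combination, multiplied by the normal density. The density is
  itself log-concave, and it makes the restrictions integrable and their level sets bounded.
\<close>

lemma log_concave_gauss_marginal:
  fixes f :: "'a::euclidean_space \<Rightarrow> real"
  assumes [measurable]: "f \<in> borel_measurable borel" and f: "log_concave f" and le1: "\<And>x. f x \<le> 1"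
  shows "log_concave (gauss_marginal b f)"
  unfolding log_concave_def
proof (intro conjI allI impI)
  note nn = log_concaveD(1)[OF f]
  note phi = normal_density_nonneg[of 0 1]
  show "0 \<le> gauss_marginal b f x" for x using gauss_marginal_range assms nn by blast
  fix x y :: 'a and l :: real assume l: "0 \<le> l" "l \<le> 1"
  define F where "F = (\<lambda>z s. std_normal_density s * f (z + (s - z \<bullet> b) *\<^sub>R b))"
  have [measurable]: "F z \<in> borel_measurable borel" for z unfolding F_def by measurable
  have eq: "gauss_marginal b f z = (\<integral>s. F z s \<partial>lborel)" for z
    unfolding gauss_marginal_def F_def by (subst integral_density) (auto simp: phi)
  have Fnn: "0 \<le> F z s" for z s unfolding F_def using nn phi by simp
  have Fle: "F z s \<le> std_normal_density s" for z s
    unfolding F_def using le1 phi by (simp add: mult_left_le)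
  have Fint: "integrable lborel (F z)" for z
    by (rule Bochner_Integration.integrable_bound[where f=std_normal_density])
       (use Fnn Fle phi in \<open>auto intro!: AE_I2 simp: abs_of_nonneg\<close>)
  have lc: "F x s powr (1 - l) * F y t powr l \<le> F ((1 - l) *\<^sub>R x + l *\<^sub>R y) ((1 - l) * s + l * t)"
    if l: "0 \<le> l" "l \<le> 1" for x y s t l
  proof -
    define p q where "p = x + (s - x \<bullet> b) *\<^sub>R b" and "q = y + (t - y \<bullet> b) *\<^sub>R b"
    define d where "d = std_normal_density"
    have pt: "(1 - l) *\<^sub>R x + l *\<^sub>R y + ((1 - l) * s + l * t - ((1 - l) *\<^sub>R x + l *\<^sub>R y) \<bullet> b) *\<^sub>R b
        = (1 - l) *\<^sub>R p + l *\<^sub>R q"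
      by (simp add: p_def q_def algebra_simps inner_add_left inner_diff_left)
    have "F x s powr (1 - l) * F y t powr l
        = (d s powr (1 - l) * d t powr l) * (f p powr (1 - l) * f q powr l)"
      using phi nn by (simp add: F_def p_def q_def d_def powr_mult)
    also have "\<dots> \<le> d ((1 - l) *\<^sub>R s + l *\<^sub>R t) * f ((1 - l) *\<^sub>R p + l *\<^sub>R q)"
      unfolding d_def using l
      by (intro mult_mono log_concaveD(2)[OF f] log_concaveD(2)[OF log_concave_std_normal_density]
          mult_nonneg_nonneg phi) auto
    also have "\<dots> = F ((1 - l) *\<^sub>R x + l *\<^sub>R y) ((1 - l) * s + l * t)"
      unfolding F_def pt by (simp add: d_def)
    finally show ?thesis .
  qed
  have Flc: "log_concave (F z)" for z
    unfolding log_concave_def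
  proof (intro conjI allI impI)
    fix s t l :: real assume "0 \<le> l" "l \<le> 1"
    moreover have "(1 - l) *\<^sub>R z + l *\<^sub>R z = z" by (simp add: algebra_simps)
    ultimately show "F z s powr (1 - l) * F z t powr l \<le> F z ((1 - l) *\<^sub>R s + l *\<^sub>R t)"
      using lc[of l z s z t] by simp
  qed (rule Fnn)
  have Fbnd: "bounded {s. c < F z s}" if "0 < c" for c z
    by (rule bounded_subset[OF bounded_superlevel_std_normal_density[OF that]])
       (use Fle in \<open>auto intro: less_le_trans\<close>)
  have Fbdd: "bdd_above (range (F z))" for z
    using Fle std_normal_density_le_1 by (intro bdd_aboveI[where M=1]) (auto intro: order_trans)
  show "gauss_marginal b f x powr (1 - l) * gauss_marginal b f y powr l
      \<le> gauss_marginal b f ((1 - l) *\<^sub>R x + l *\<^sub>R y)"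
    unfolding eq
    by (rule Prekopa_Leindler_real)
       (use Fint Fnn Fbdd Fbnd l lc log_concave_imp_convex_superlevel[OF Flc] in auto)
qed

lemma even_gauss_marginal:
  assumes [measurable]: "f \<in> borel_measurable borel" and ev: "\<And>x. f (- x) = f x"
  shows "gauss_marginal b f (- z) = gauss_marginal b f z"
proof -
  define F where "F = (\<lambda>z s. std_normal_density s * f (z + (s - z \<bullet> b) *\<^sub>R b))"
  have eq: "gauss_marginal b f z = (\<integral>s. F z s \<partial>lborel)" for z
    unfolding gauss_marginal_def F_def by (subst integral_density) (auto simp: normal_density_nonneg)
  have "F (- z) (- s) = F z s" for s
    using ev[of "z + (s - z \<bullet> b) *\<^sub>R b"]
    by (simp add: F_def normal_density_def algebra_simps)
  then have "(\<integral>s. F z s \<partial>lborel) = (\<integral>s. F (- z) (0 + (-1) * s) \<partial>lborel)" by simp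
  also have "\<dots> = (\<integral>s. F (- z) s \<partial>lborel)"
    using lborel_integral_real_affine[of "-1" "F (- z)" 0] by simp
  finally show ?thesis by (simp add: eq)
qed

lemma gauss_marginal_translate:
  assumes "b \<in> Basis" shows "gauss_marginal b f (z + c *\<^sub>R b) = gauss_marginal b f z"
  using assms by (simp add: gauss_marginal_def inner_add_left algebra_simps)

lemma gauss_marginal_translate_orthogonal:
  assumes "\<And>z. f (z + c *\<^sub>R d) = f z" "d \<bullet> b = 0"
  shows "gauss_marginal b f (z + c *\<^sub>R d) = gauss_marginal b f z"
proof -
  have "f (z + c *\<^sub>R d + (y - (z + c *\<^sub>R d) \<bullet> b) *\<^sub>R b) = f (z + (y - z \<bullet> b) *\<^sub>R b)" for y
    using assms(1)[of "z + (y - z \<bullet> b) *\<^sub>R b"] assms(2) by (simp add: inner_add_left algebra_simps)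
  then show ?thesis by (simp add: gauss_marginal_def)
qed

section \<open>The standard Gaussian measure as a product\<close>

lemma prod_UNIV_eq_prod_Basis:
  fixes z :: "real ^ 'n"
  shows "(\<Prod>i\<in>UNIV. f (z $ i)) = (\<Prod>b\<in>Basis. f (z \<bullet> b))"
proof -
  have B: "Basis = (\<lambda>i::'n. axis i (1::real)) ` UNIV" by (auto simp: Basis_vec_def)
  have "inj (\<lambda>i::'n. axis i (1::real))" by (auto simp: inj_on_def axis_eq_axis)
  then show ?thesis unfolding B by (subst prod.reindex) (auto simp: inner_axis)
qed

lemma borel_measurable_sum_Basis:
  assumes "sets N = sets borel"
  shows "(\<lambda>g. \<Sum>b\<in>Basis. g b *\<^sub>R b :: 'a::euclidean_space) \<in> Pi\<^sub>M Basis (\<lambda>_. N) \<rightarrow>\<^sub>M borel"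
proof -
  have "(\<lambda>g. g b) \<in> borel_measurable (Pi\<^sub>M Basis (\<lambda>_. N))" if "b \<in> Basis" for b :: 'a
    using measurable_component_singleton[OF that, of "\<lambda>_. N"] assms by (simp cong: measurable_cong_sets)
  then show ?thesis by (intro borel_measurable_sum borel_measurable_scaleR) auto
qed

lemma borel_measurable_sum_Basis_gauss1 [measurable]:
  "(\<lambda>g. \<Sum>b\<in>Basis. g b *\<^sub>R b :: 'a::euclidean_space) \<in> Pi\<^sub>M Basis (\<lambda>_. gauss1) \<rightarrow>\<^sub>M borel"
  by (rule borel_measurable_sum_Basis) simp

text \<open>
  Lebesgue measure is the image of a product over the coordinates, and the density factorises; so
  coordinates can be integrated out one at a time.
\<close>

lemma standard_gaussian_eq_distr_PiM:
  "standard_gaussian = distr (Pi\<^sub>M Basis (\<lambda>_. gauss1)) borel (\<lambda>g. \<Sum>b\<in>Basis. g b *\<^sub>R b :: real ^ 'n)"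
proof -
  let ?B = "Basis :: (real ^ 'n) set"
  let ?L = "Pi\<^sub>M ?B (\<lambda>_. lborel :: real measure)"
  let ?d = "\<lambda>z :: real ^ 'n. ennreal (\<Prod>b\<in>?B. std_normal_density (z \<bullet> b))"
  interpret L: product_sigma_finite "\<lambda>_. lborel :: real measure" ..
  interpret P: prob_space gauss1 by (rule prob_space_gauss1)
  interpret G: product_sigma_finite "\<lambda>_. gauss1" ..
  let ?s = "\<lambda>g. \<Sum>b\<in>?B. g b *\<^sub>R b"
  have s [measurable]: "?s \<in> ?L \<rightarrow>\<^sub>M borel" by (rule borel_measurable_sum_Basis) simp
  have comp: "?s g \<bullet> b = g b" if "b \<in> ?B" for g b using that by simp
  have "standard_gaussian = density (distr ?L borel ?s) ?d"
    unfolding standard_gaussian_def prod_UNIV_eq_prod_Basis lborel_eq[where 'a="real ^ 'n"] by simp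
  also have "\<dots> = distr (density ?L (\<lambda>g. ?d (?s g))) borel ?s"
    by (rule density_distr) measurable
  also have "density ?L (\<lambda>g. ?d (?s g)) = Pi\<^sub>M ?B (\<lambda>_. gauss1)"
  proof (rule G.PiM_eqI)
    show "sets (density ?L (\<lambda>g. ?d (?s g))) = sets (Pi\<^sub>M ?B (\<lambda>_. gauss1))"
      by (simp cong: sets_PiM_cong)
    fix A assume A: "\<And>i. i \<in> ?B \<Longrightarrow> A i \<in> sets gauss1"
    have meas: "(\<lambda>x. ennreal (std_normal_density x) * indicator (A c) x) \<in> borel_measurable lborel" if "c \<in> ?B" for c
      using A[OF that] by simp
    have "Pi\<^sub>E ?B A \<in> sets ?L" using A by (intro sets_PiM_I_finite) auto
    then have "emeasure (density ?L (\<lambda>g. ?d (?s g))) (Pi\<^sub>E ?B A)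
        = (\<integral>\<^sup>+g. ?d (?s g) * indicator (Pi\<^sub>E ?B A) g \<partial>?L)"
      by (subst emeasure_density) auto
    also have "\<dots> = (\<integral>\<^sup>+g. (\<Prod>c\<in>?B. ennreal (std_normal_density (g c)) * indicator (A c) (g c)) \<partial>?L)"
    proof (rule nn_integral_cong)
      fix g assume g: "g \<in> space ?L"
      have "(\<Prod>c\<in>?B. indicator (A c) (g c)) = (indicator (Pi\<^sub>E ?B A) g :: ennreal)"
      proof (cases "g \<in> Pi\<^sub>E ?B A")
        case True
        then have "\<And>c. c \<in> ?B \<Longrightarrow> g c \<in> A c" by (auto simp: PiE_iff)
        with True show ?thesis by simp
      next
        case False
        then obtain c where "c \<in> ?B" "g c \<notin> A c" using g by (auto simp: PiE_iff space_PiM)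
        then have "(\<Prod>c\<in>?B. indicator (A c) (g c)) = (0 :: ennreal)" by (intro prod_zero bexI[of _ c]) auto
        with False show ?thesis by simp
      qed
      moreover have "?d (?s g) = (\<Prod>c\<in>?B. ennreal (std_normal_density (g c)))"
        by (simp add: prod_ennreal normal_density_nonneg)
      ultimately show "?d (?s g) * indicator (Pi\<^sub>E ?B A) g
          = (\<Prod>c\<in>?B. ennreal (std_normal_density (g c)) * indicator (A c) (g c))"
        by (simp add: prod.distrib)
    qed
    also have "\<dots> = (\<Prod>c\<in>?B. \<integral>\<^sup>+x. ennreal (std_normal_density x) * indicator (A c) x \<partial>lborel)"
      by (rule L.product_nn_integral_prod[OF finite_Basis meas])
    also have "\<dots> = (\<Prod>c\<in>?B. emeasure gauss1 (A c))"
      using A by (intro prod.cong refl) (subst emeasure_density; auto)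
    finally show "emeasure (density ?L (\<lambda>g. ?d (?s g))) (Pi\<^sub>E ?B A) = (\<Prod>c\<in>?B. emeasure gauss1 (A c))" .
  qed simp
  finally show ?thesis .
qed

lemma sets_standard_gaussian [simp, measurable_cong]: "sets standard_gaussian = sets borel"
  and space_standard_gaussian [simp]: "space standard_gaussian = UNIV"
  by (simp_all add: standard_gaussian_def)

lemma prob_space_standard_gaussian: "prob_space (standard_gaussian :: (real ^ 'n) measure)"
proof -
  interpret P: prob_space gauss1 by (rule prob_space_gauss1)
  interpret G: finite_product_prob_space "\<lambda>_. gauss1" "Basis :: (real ^ 'n) set" by standard simp
  show ?thesis unfolding standard_gaussian_eq_distr_PiM by (rule G.prob_space_distr) simp
qed

lemma distr_standard_gaussian_component:
  fixes b :: "real ^ 'n"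
  assumes b: "b \<in> Basis"
  shows "distr standard_gaussian borel (\<lambda>z. z \<bullet> b) = gauss1"
proof -
  interpret P: prob_space gauss1 by (rule prob_space_gauss1)
  interpret G: finite_product_prob_space "\<lambda>_. gauss1" "Basis :: (real ^ 'n) set" by standard simp
  have "distr standard_gaussian borel (\<lambda>z. z \<bullet> b)
      = distr (Pi\<^sub>M Basis (\<lambda>_. gauss1)) borel (\<lambda>g. (\<Sum>c\<in>Basis. g c *\<^sub>R c) \<bullet> b)"
    unfolding standard_gaussian_eq_distr_PiM by (subst distr_distr) (auto simp: comp_def)
  also have "\<dots> = distr (Pi\<^sub>M Basis (\<lambda>_. gauss1)) gauss1 (\<lambda>g. g b)"
    using b by (intro distr_cong) auto
  also have "\<dots> = gauss1" using distr_PiM_component[of Basis "\<lambda>_. gauss1" b] b P.prob_space_axioms by simp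
  finally show ?thesis .
qed

text \<open>
  Tonelli for the coordinate along \<open>b\<close>. On the right the inner integral ignores the coordinate of
  \<open>z\<close> along \<open>b\<close>, and the integration over that coordinate contributes the factor 1.
\<close>

lemma nn_integral_standard_gaussian_marginal:
  fixes F :: "real ^ 'n \<Rightarrow> ennreal"
  assumes [measurable]: "F \<in> borel_measurable borel" and b: "b \<in> Basis"
  shows "(\<integral>\<^sup>+z. F z \<partial>standard_gaussian)
       = (\<integral>\<^sup>+z. \<integral>\<^sup>+y. F (z + (y - z \<bullet> b) *\<^sub>R b) \<partial>gauss1 \<partial>standard_gaussian)"
proof -
  interpret P: prob_space gauss1 by (rule prob_space_gauss1)
  interpret G: product_sigma_finite "\<lambda>_. gauss1" ..
  let ?B = "Basis :: (real ^ 'n) set"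
  let ?s = "\<lambda>g. \<Sum>b\<in>?B. g b *\<^sub>R b"
  define J where "J = ?B - {b}"
  have J: "finite J" "b \<notin> J" "insert b J = ?B" using b by (auto simp: J_def)
  have split: "?s (x(b := y)) = y *\<^sub>R b + (\<Sum>c\<in>J. x c *\<^sub>R c)" for x y
  proof -
    have "?s (x(b := y)) = (\<Sum>c\<in>insert b J. (x(b := y)) c *\<^sub>R c)" by (simp only: J(3))
    also have "\<dots> = y *\<^sub>R b + (\<Sum>c\<in>J. (x(b := y)) c *\<^sub>R c)"
      by (subst sum.insert[OF J(1,2)]) simp
    also have "(\<Sum>c\<in>J. (x(b := y)) c *\<^sub>R c) = (\<Sum>c\<in>J. x c *\<^sub>R c)"
      using J by (intro sum.cong) auto
    finally show ?thesis .
  qed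
  have comp: "?s (x(b := y)) \<bullet> b = y" for x y using b by simp
  have ins: "(\<integral>\<^sup>+g. H (?s g) \<partial>Pi\<^sub>M ?B (\<lambda>_. gauss1))
      = (\<integral>\<^sup>+x. \<integral>\<^sup>+y. H (?s (x(b := y))) \<partial>gauss1 \<partial>Pi\<^sub>M J (\<lambda>_. gauss1))"
    if [measurable]: "H \<in> borel_measurable borel" for H :: "real ^ 'n \<Rightarrow> ennreal"
    by (rule G.product_nn_integral_insert[of J b "\<lambda>g. H (?s g)", unfolded J(3)]) (use J in auto)
  have dist: "(\<integral>\<^sup>+z. H z \<partial>standard_gaussian) = (\<integral>\<^sup>+g. H (?s g) \<partial>Pi\<^sub>M ?B (\<lambda>_. gauss1))"
    if [measurable]: "H \<in> borel_measurable borel" for H :: "real ^ 'n \<Rightarrow> ennreal"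
    unfolding standard_gaussian_eq_distr_PiM by (subst nn_integral_distr) auto
  define H where "H = (\<lambda>z. \<integral>\<^sup>+y. F (z + (y - z \<bullet> b) *\<^sub>R b) \<partial>gauss1)"
  have [measurable]: "H \<in> borel_measurable borel" unfolding H_def by measurable
  have "?s (x(b := y')) + (y - ?s (x(b := y')) \<bullet> b) *\<^sub>R b = ?s (x(b := y))" for x y y'
    unfolding comp unfolding split by (simp add: algebra_simps)
  then have "H (?s (x(b := y'))) = (\<integral>\<^sup>+y. F (?s (x(b := y))) \<partial>gauss1)" for x y'
    unfolding H_def by simp
  then have "(\<integral>\<^sup>+z. H z \<partial>standard_gaussian)
      = (\<integral>\<^sup>+x. \<integral>\<^sup>+y. F (?s (x(b := y))) \<partial>gauss1 \<partial>Pi\<^sub>M J (\<lambda>_. gauss1))"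
    by (simp add: dist ins P.emeasure_space_1[simplified])
  also have "\<dots> = (\<integral>\<^sup>+z. F z \<partial>standard_gaussian)" by (simp add: dist ins)
  finally show ?thesis by (simp add: H_def)
qed

text \<open>
  For \<open>D = Basis - {b}\<close> the function \<open>G\<close> is the conditional expectation of \<open>f\<close> given the coordinate
  along \<open>b\<close>. The induction on \<open>D\<close> integrates out one coordinate at a time; a weight \<open>h\<close> that depends
  only on \<open>z \<bullet> b\<close> passes through each integration.
\<close>

lemma log_concave_even_marginal_exists:
  fixes f :: "real ^ 'n \<Rightarrow> real" and b :: "real ^ 'n"
  assumes f: "f \<in> borel_measurable borel" "log_concave f" "\<And>z. f z \<le> 1" "\<And>z. f (- z) = f z"
    and b: "b \<in> Basis" and D: "D \<subseteq> Basis - {b}"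
  shows "\<exists>G. G \<in> borel_measurable borel \<and> log_concave G \<and> (\<forall>z. G z \<le> 1) \<and> (\<forall>z. G (- z) = G z) \<and>
     (\<forall>d\<in>D. \<forall>z c. G (z + c *\<^sub>R d) = G z) \<and>
     (\<forall>h \<in> borel_measurable borel. (\<integral>\<^sup>+z. ennreal (f z) * h (z \<bullet> b) \<partial>standard_gaussian)
        = (\<integral>\<^sup>+z. ennreal (G z) * h (z \<bullet> b) \<partial>standard_gaussian))"
  using finite_subset[OF D finite_Diff[OF finite_Basis]] D
proof (induction D rule: finite_induct)
  case empty
  show ?case using f by (intro exI[of _ f]) auto
next
  case (insert d D)
  then obtain G where G [measurable]: "G \<in> borel_measurable borel" and lc: "log_concave G"
    and le1: "\<And>z. G z \<le> 1" and ev: "\<And>z. G (- z) = G z"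
    and inv: "\<And>d z c. d \<in> D \<Longrightarrow> G (z + c *\<^sub>R d) = G z"
    and int: "\<And>h. h \<in> borel_measurable borel \<Longrightarrow>
       (\<integral>\<^sup>+z. ennreal (f z) * h (z \<bullet> b) \<partial>standard_gaussian) = (\<integral>\<^sup>+z. ennreal (G z) * h (z \<bullet> b) \<partial>standard_gaussian)"
    by auto
  have d: "d \<in> Basis" "d \<bullet> b = 0"
    using insert.prems b by (auto simp: inner_not_same_Basis)
  have d3: "c \<bullet> d = 0" if "c \<in> D" for c
    using that insert.prems insert.hyps d(1) by (intro inner_not_same_Basis) auto
  note nn = log_concaveD(1)[OF lc]
  let ?G = "gauss_marginal d G"
  have "(\<integral>\<^sup>+z. ennreal (f z) * h (z \<bullet> b) \<partial>standard_gaussian) = (\<integral>\<^sup>+z. ennreal (?G z) * h (z \<bullet> b) \<partial>standard_gaussian)"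
    if [measurable]: "h \<in> borel_measurable borel" for h
  proof -
    have "(\<integral>\<^sup>+z. ennreal (f z) * h (z \<bullet> b) \<partial>standard_gaussian)
        = (\<integral>\<^sup>+z. ennreal (G z) * h (z \<bullet> b) \<partial>standard_gaussian)" by (rule int) fact
    also have "\<dots> = (\<integral>\<^sup>+z. \<integral>\<^sup>+y. ennreal (G (z + (y - z \<bullet> d) *\<^sub>R d)) * h (z \<bullet> b) \<partial>gauss1 \<partial>standard_gaussian)"
      using d by (subst nn_integral_standard_gaussian_marginal[of _ d]) (auto simp: inner_add_left)
    also have "\<dots> = (\<integral>\<^sup>+z. (\<integral>\<^sup>+y. ennreal (G (z + (y - z \<bullet> d) *\<^sub>R d)) \<partial>gauss1) * h (z \<bullet> b) \<partial>standard_gaussian)"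
      by (simp add: nn_integral_multc)
    also have "\<dots> = (\<integral>\<^sup>+z. ennreal (?G z) * h (z \<bullet> b) \<partial>standard_gaussian)"
      unfolding gauss_marginal_def using nn le1
      by (subst nn_integral_eq_integral) (auto intro: integrable_gauss1_bounded)
    finally show ?thesis .
  qed
  then show ?case
    using log_concave_gauss_marginal[OF G lc le1, of d] borel_measurable_gauss_marginal[OF G, of d]
      gauss_marginal_range(2)[OF G nn le1, of d] even_gauss_marginal[OF G ev, of d]
      gauss_marginal_translate[OF d(1), of G] gauss_marginal_translate_orthogonal[of G _ _ d] inv d3
    by (intro exI[of _ ?G]) auto
qed

section \<open>Rotations and translations of the standard Gaussian measure\<close>

text \<open>
  The argument for the uniqueness of translation-invariant measures. Integrate
  \<open>indicator B x * indicator A (y + f x)\<close> over all \<open>(x, y)\<close>, where \<open>B\<close> is the unit ball. Translating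
  \<open>y\<close> removes \<open>f x\<close> and yields \<open>vol B * vol A\<close>; translating \<open>x\<close> by \<open>- f' y\<close>, with \<open>f'\<close> the inverse
  of \<open>f\<close>, yields \<open>vol B * vol (f -` A)\<close>, because \<open>B\<close> is invariant under \<open>f\<close>.
\<close>

lemma lborel_distr_orthogonal_transformation:
  fixes f :: "'a::euclidean_space \<Rightarrow> 'a"
  assumes f: "orthogonal_transformation f"
  shows "distr lborel borel f = lborel"
proof (rule measure_eqI)
  have lin: "linear f" using f by (rule orthogonal_transformation_linear)
  have [measurable]: "f \<in> borel_measurable borel"
    by (intro borel_measurable_continuous_onI linear_continuous_on linear_conv_bounded_linear[THEN iffD1] lin)
  define f' where "f' = inv f"
  have f': "orthogonal_transformation f'" unfolding f'_def using f by (rule orthogonal_transformation_inv)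
  have [measurable]: "f' \<in> borel_measurable borel"
    by (intro borel_measurable_continuous_onI linear_continuous_on linear_conv_bounded_linear[THEN iffD1]
        orthogonal_transformation_linear f')
  have ff': "f (f' x) = x" for x
    unfolding f'_def using orthogonal_transformation_surj[OF f] by (rule surj_f_inv_f)
  have transl: "(\<integral>\<^sup>+x. h (x + a) \<partial>lborel) = (\<integral>\<^sup>+x. h x \<partial>lborel)"
    if [measurable]: "h \<in> borel_measurable borel" for h :: "'a \<Rightarrow> ennreal" and a
    by (subst (2) lborel_distr_plus[of a, symmetric]) (simp add: nn_integral_distr add.commute)
  define B where "B = (ball 0 1 :: 'a set)"
  define V where "V = emeasure lborel B"
  have [measurable]: "B \<in> sets borel" by (simp add: B_def)
  have "unit_ball_vol (real DIM('a)) \<noteq> 0"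
    using unit_ball_vol_pos[of "real DIM('a)"] by linarith
  then have V: "V \<noteq> 0" "V \<noteq> \<infinity>"
    unfolding V_def B_def using emeasure_lborel_ball_finite[of "0::'a" 1]
    by (auto simp: emeasure_ball content_ball less_top[symmetric])
  fix A :: "'a set" assume "A \<in> sets (distr lborel borel f)"
  then have [measurable]: "A \<in> sets borel" by simp
  have "V * emeasure lborel A = (\<integral>\<^sup>+x. \<integral>\<^sup>+y. indicator B x * indicator A y \<partial>lborel \<partial>lborel)"
    by (simp add: V_def nn_integral_cmult nn_integral_multc)
  also have "\<dots> = (\<integral>\<^sup>+x. \<integral>\<^sup>+y. indicator B x * indicator A (y + f x) \<partial>lborel \<partial>lborel)"
    by (rule nn_integral_cong, rule transl[symmetric], measurable)
  also have "\<dots> = (\<integral>\<^sup>+y. \<integral>\<^sup>+x. indicator B x * indicator A (y + f x) \<partial>lborel \<partial>lborel)"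
    by (rule lborel_pair.Fubini') measurable
  also have "\<dots> = (\<integral>\<^sup>+y. \<integral>\<^sup>+x. indicator B (x + - f' y) * indicator A (y + f (x + - f' y)) \<partial>lborel \<partial>lborel)"
    by (rule nn_integral_cong, rule transl[symmetric], measurable)
  also have "\<dots> = (\<integral>\<^sup>+y. \<integral>\<^sup>+x. indicator B (x + - f' y) * indicator A (f x) \<partial>lborel \<partial>lborel)"
    by (simp add: linear_diff[OF lin] ff')
  also have "\<dots> = (\<integral>\<^sup>+x. \<integral>\<^sup>+y. indicator B (x + - f' y) * indicator A (f x) \<partial>lborel \<partial>lborel)"
    by (rule lborel_pair.Fubini') measurable
  also have "\<dots> = (\<integral>\<^sup>+x. \<integral>\<^sup>+y. indicator B (y + - f x) * indicator A (f x) \<partial>lborel \<partial>lborel)"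
  proof (intro nn_integral_cong)
    fix x y
    have "norm (x + - f' y) = norm (f (x + - f' y))" using f by (simp add: orthogonal_transformation_norm)
    also have "\<dots> = norm (y + - f x)" by (simp add: linear_diff[OF lin] ff' norm_minus_commute)
    finally show "indicator B (x + - f' y) * indicator A (f x) = (indicator B (y + - f x) * indicator A (f x) :: ennreal)"
      by (simp add: B_def indicator_def)
  qed
  also have "\<dots> = (\<integral>\<^sup>+x. \<integral>\<^sup>+y. indicator B y * indicator A (f x) \<partial>lborel \<partial>lborel)"
    by (rule nn_integral_cong, rule transl, measurable)
  also have "\<dots> = V * (\<integral>\<^sup>+x. indicator A (f x) \<partial>lborel)"
    by (simp add: V_def nn_integral_cmult nn_integral_multc)
  also have "(\<integral>\<^sup>+x. indicator A (f x) \<partial>lborel) = emeasure (distr lborel borel f) A"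
    by (subst nn_integral_indicator[symmetric], simp, subst nn_integral_distr) auto
  finally show "emeasure (distr lborel borel f) A = emeasure lborel A"
    using V by (simp add: ennreal_mult_cancel_left)
qed simp

lemma std_gaussian_density_norm:
  fixes z :: "real ^ 'n"
  shows "(\<Prod>i\<in>UNIV. std_normal_density (z $ i)) = (1 / sqrt (2 * pi)) ^ CARD('n) * exp (- (norm z)\<^sup>2 / 2)"
proof -
  have "(\<Prod>i\<in>UNIV. std_normal_density (z $ i))
      = (1 / sqrt (2 * pi)) ^ CARD('n) * (\<Prod>i\<in>UNIV. exp (- (z $ i)\<^sup>2 / 2))"
    by (simp only: std_normal_density_def prod.distrib prod_constant)
  also have "(\<Prod>i\<in>UNIV. exp (- (z $ i)\<^sup>2 / 2)) = exp (- (norm z)\<^sup>2 / 2)"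
    by (simp add: exp_sum[symmetric] sum_negf sum_divide_distrib[symmetric] norm_vec_def L2_set_def sum_nonneg)
  finally show ?thesis .
qed

lemma standard_gaussian_rotation_invariant:
  fixes f :: "real ^ 'n \<Rightarrow> real ^ 'n"
  assumes f: "orthogonal_transformation f"
  shows "distr standard_gaussian borel f = standard_gaussian"
proof -
  have [measurable]: "f \<in> borel_measurable borel"
    by (intro borel_measurable_continuous_onI linear_continuous_on linear_conv_bounded_linear[THEN iffD1]
        orthogonal_transformation_linear f)
  let ?d = "\<lambda>z :: real ^ 'n. ennreal (\<Prod>i\<in>UNIV. std_normal_density (z $ i))"
  have "?d (f z) = ?d z" for z
    using f by (simp add: std_gaussian_density_norm orthogonal_transformation_norm)
  then have "distr standard_gaussian borel f = distr (density lborel (\<lambda>z. ?d (f z))) borel f"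
    by (simp add: standard_gaussian_def)
  also have "\<dots> = density (distr lborel borel f) ?d"
    by (rule density_distr[symmetric]) measurable
  also have "\<dots> = standard_gaussian"
    unfolding lborel_distr_orthogonal_transformation[OF f] standard_gaussian_def ..
  finally show ?thesis .
qed

lemma orthogonal_transformation_uminus: "orthogonal_transformation (\<lambda>x::'a::real_inner. - x)"
  by (simp add: orthogonal_transformation_def linear_uminus)

text \<open>
  Translate Lebesgue measure and complete the square in the density.
\<close>

lemma emeasure_gaussian_shift:
  fixes b :: "real ^ 'n"
  assumes [measurable]: "S \<in> sets borel" and b: "norm b = 1"
  shows "emeasure standard_gaussian {z. z - c *\<^sub>R b \<in> S}
       = (\<integral>\<^sup>+z. ennreal (indicator S z * exp (- c\<^sup>2 / 2) * exp (- c * (z \<bullet> b))) \<partial>standard_gaussian)"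
proof -
  let ?d = "\<lambda>z :: real ^ 'n. (\<Prod>i\<in>UNIV. std_normal_density (z $ i))"
  have d0: "0 \<le> ?d z" for z by (intro prod_nonneg) (auto simp: normal_density_nonneg)
  have shift: "?d (c *\<^sub>R b + z) = ?d z * (exp (- c\<^sup>2 / 2) * exp (- c * (z \<bullet> b)))" for z
  proof -
    have "(norm (c *\<^sub>R b + z))\<^sup>2 = (norm z)\<^sup>2 + c\<^sup>2 + 2 * c * (z \<bullet> b)"
    proof -
      have "(norm (c *\<^sub>R b + z))\<^sup>2 = z \<bullet> z + c\<^sup>2 * (b \<bullet> b) + 2 * c * (z \<bullet> b)"
        unfolding power2_norm_eq_inner
        by (simp add: inner_add_left inner_add_right inner_commute power2_eq_square algebra_simps)
      then show ?thesis using b by (simp add: norm_eq_1 power2_norm_eq_inner)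
    qed
    then show ?thesis unfolding std_gaussian_density_norm
      by (simp add: exp_add[symmetric] field_simps)
  qed
  have "emeasure standard_gaussian {z. z - c *\<^sub>R b \<in> S}
      = (\<integral>\<^sup>+z. ennreal (?d z) * indicator {z. z - c *\<^sub>R b \<in> S} z \<partial>lborel)"
    unfolding standard_gaussian_def by (rule emeasure_density) measurable
  also have "\<dots> = (\<integral>\<^sup>+z. ennreal (?d z) * indicator S (z - c *\<^sub>R b) \<partial>lborel)"
    by (simp add: indicator_def)
  also have "\<dots> = (\<integral>\<^sup>+z. ennreal (?d (c *\<^sub>R b + z)) * indicator S z \<partial>lborel)"
    by (subst lborel_distr_plus[of "c *\<^sub>R b", symmetric]) (subst nn_integral_distr; simp)
  also have "\<dots> = (\<integral>\<^sup>+z. ennreal (?d z) * ennreal (indicator S z * exp (- c\<^sup>2 / 2) * exp (- c * (z \<bullet> b))) \<partial>lborel)"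
    unfolding shift using d0 by (intro nn_integral_cong) (auto simp: indicator_def ennreal_mult)
  also have "\<dots> = (\<integral>\<^sup>+z. ennreal (indicator S z * exp (- c\<^sup>2 / 2) * exp (- c * (z \<bullet> b))) \<partial>standard_gaussian)"
    unfolding standard_gaussian_def by (rule nn_integral_density[symmetric]) measurable
  finally show ?thesis .
qed

text \<open>
  The exponential weight of the previous lemma is averaged with its reflection at the origin, under
  which both \<open>S\<close> and the Gaussian measure are invariant. The case \<open>S = UNIV\<close> shows that the hyperbolic
  cosine is integrable.
\<close>

lemma
  fixes b :: "real ^ 'n"
  assumes S [measurable]: "S \<in> sets borel" and sym: "\<And>z. - z \<in> S \<longleftrightarrow> z \<in> S" and b: "norm b = 1"
  shows integrable_cosh_gaussian: "integrable standard_gaussian (\<lambda>z. indicator S z * cosh (c * (z \<bullet> b)))"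
    and measure_gaussian_shift: "measure standard_gaussian {z. z - c *\<^sub>R b \<in> S}
       = exp (- c\<^sup>2 / 2) * (\<integral>z. indicator S z * cosh (c * (z \<bullet> b)) \<partial>standard_gaussian)"
proof -
  interpret prob_space "standard_gaussian :: (real ^ 'n) measure" by (rule prob_space_standard_gaussian)
  let ?E = "\<lambda>z. indicator S z * exp (- c\<^sup>2 / 2) * exp (- c * (z \<bullet> b)) :: real"
  have nn: "(\<integral>\<^sup>+z. ennreal (?E z) \<partial>standard_gaussian) = ennreal (measure standard_gaussian {z. z - c *\<^sub>R b \<in> S})"
    by (simp only: emeasure_gaussian_shift[OF S b, symmetric] emeasure_eq_measure)
  have E: "has_bochner_integral standard_gaussian ?E (measure standard_gaussian {z. z - c *\<^sub>R b \<in> S})"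
    by (rule has_bochner_integral_nn_integral) (use nn in auto)
  have E': "has_bochner_integral standard_gaussian (\<lambda>z. ?E (- z)) (measure standard_gaussian {z. z - c *\<^sub>R b \<in> S})"
    using E integrable_distr_eq[of uminus standard_gaussian borel ?E]
      integral_distr[of uminus standard_gaussian borel ?E]
    unfolding has_bochner_integral_iff standard_gaussian_rotation_invariant[OF orthogonal_transformation_uminus]
    by simp
  have "has_bochner_integral standard_gaussian (\<lambda>z. exp (c\<^sup>2 / 2) * ((?E z + ?E (- z)) / 2))
      (exp (c\<^sup>2 / 2) * ((measure standard_gaussian {z. z - c *\<^sub>R b \<in> S} + measure standard_gaussian {z. z - c *\<^sub>R b \<in> S}) / 2))"
    by (intro has_bochner_integral_mult_right has_bochner_integral_divide has_bochner_integral_add E E')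
  also have "(\<lambda>z. exp (c\<^sup>2 / 2) * ((?E z + ?E (- z)) / 2)) = (\<lambda>z. indicator S z * cosh (c * (z \<bullet> b)))"
    using sym by (auto simp: fun_eq_iff indicator_def cosh_def exp_minus field_simps)
  finally have *: "has_bochner_integral standard_gaussian (\<lambda>z. indicator S z * cosh (c * (z \<bullet> b)))
     (exp (c\<^sup>2 / 2) * measure standard_gaussian {z. z - c *\<^sub>R b \<in> S})" by simp
  then show "integrable standard_gaussian (\<lambda>z. indicator S z * cosh (c * (z \<bullet> b)))"
    by (simp add: has_bochner_integral_iff)
  show "measure standard_gaussian {z. z - c *\<^sub>R b \<in> S}
       = exp (- c\<^sup>2 / 2) * (\<integral>z. indicator S z * cosh (c * (z \<bullet> b)) \<partial>standard_gaussian)"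
    using * by (simp add: has_bochner_integral_iff exp_minus)
qed

section \<open>Translates of symmetric convex sets\<close>

text \<open>
  The point \<open>s b\<close> lies between \<open>t b\<close> and \<open>- t b\<close>, where the function has equal values.
\<close>

lemma log_concave_even_antimono:
  assumes f: "log_concave f" and ev: "\<And>z. f (- z) = f z" and s: "\<bar>s\<bar> \<le> \<bar>t\<bar>"
  shows "f (t *\<^sub>R b) \<le> f (s *\<^sub>R b)"
proof (cases "t = 0")
  case False
  define l where "l = (1 - s / t) / 2"
  have "\<bar>s / t\<bar> \<le> 1" using s False by (simp add: abs_divide)
  then have "s / t \<le> 1" "- 1 \<le> s / t" by linarith+
  then have l: "0 \<le> l" "l \<le> 1" by (simp_all add: l_def)
  have "(1 - l) *\<^sub>R (t *\<^sub>R b) + l *\<^sub>R (- (t *\<^sub>R b)) = ((1 - l) * t - l * t) *\<^sub>R b"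
    by (simp add: scaleR_diff_left)
  also have "(1 - l) * t - l * t = s" using False by (simp add: l_def field_simps)
  finally show ?thesis using log_concave_ge_min[OF f l, of "t *\<^sub>R b" "- (t *\<^sub>R b)"] ev by simp
qed (use s in auto)

lemma translation_invariant_eq_component:
  fixes G :: "'a::euclidean_space \<Rightarrow> 'b"
  assumes b: "b \<in> Basis" and inv: "\<And>d z c. d \<in> Basis - {b} \<Longrightarrow> G (z + c *\<^sub>R d) = G z"
  shows "G z = G ((z \<bullet> b) *\<^sub>R b)"
proof -
  have "G (v + (\<Sum>d\<in>D. (z \<bullet> d) *\<^sub>R d)) = G v" if "finite D" "D \<subseteq> Basis - {b}" for D v
    using that
  proof (induction D rule: finite_induct)
    case (insert d D)
    have eq: "v + (\<Sum>d\<in>insert d D. (z \<bullet> d) *\<^sub>R d) = (v + (\<Sum>d\<in>D. (z \<bullet> d) *\<^sub>R d)) + (z \<bullet> d) *\<^sub>R d"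
      using insert.hyps by simp
    show ?case unfolding eq using insert inv[of d] by (simp del: sum.insert)
  qed simp
  from this[of "Basis - {b}" "(z \<bullet> b) *\<^sub>R b"]
  have "G ((z \<bullet> b) *\<^sub>R b + (\<Sum>d\<in>Basis - {b}. (z \<bullet> d) *\<^sub>R d)) = G ((z \<bullet> b) *\<^sub>R b)" by simp
  also have "(z \<bullet> b) *\<^sub>R b + (\<Sum>d\<in>Basis - {b}. (z \<bullet> d) *\<^sub>R d) = (\<Sum>d\<in>Basis. (z \<bullet> d) *\<^sub>R d)"
    using b by (simp add: sum.remove)
  finally show ?thesis by (simp add: euclidean_representation)
qed

lemma log_concave_indicator_convex:
  assumes "convex K" shows "log_concave (indicator K)"
  unfolding log_concave_def
proof (intro conjI allI impI)
  fix x y l assume l: "0 \<le> l" "l \<le> (1 :: real)"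
  show "indicator K x powr (1 - l) * indicator K y powr l \<le> indicator K ((1 - l) *\<^sub>R x + l *\<^sub>R y)"
  proof (cases "x \<in> K \<and> y \<in> K")
    case True
    then have "(1 - l) *\<^sub>R x + l *\<^sub>R y \<in> K" using assms l by (auto simp: convex_alt)
    with True show ?thesis by simp
  qed auto
qed simp

lemma cosh_mult_le_iff:
  fixes c s :: real
  assumes "0 < c" "0 \<le> t"
  shows "cosh (c * t) \<le> cosh (c * s) \<longleftrightarrow> t \<le> \<bar>s\<bar>"
proof -
  have eq: "cosh (c * s) = cosh (c * \<bar>s\<bar>)" by (cases "s \<ge> 0") auto
  show ?thesis unfolding eq using assms by (simp add: cosh_real_nonneg_le_iff)
qed

text \<open>
  The second bound, with the set \<open>J\<close> describing a slab, is Chebyshev's correlation inequality for the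
  conditional measure \<open>G\<close> of \<open>K\<close> given \<open>z \<bullet> b\<close>, which decreases in \<open>\<bar>z \<bullet> b\<bar>\<close>, and the weight
  \<open>C = cosh (c (z \<bullet> b))\<close>, which increases. It needs no double integral: let \<open>s0\<close> be the point at which
  the weight equals its mean \<open>m\<close> over the slab. Then \<open>G - G (s0 b)\<close> and \<open>C - m\<close> have opposite signs
  everywhere, so the integral of their product over the slab is not positive, and the constant
  \<open>G (s0 b)\<close> drops out because \<open>C - m\<close> has integral zero.
\<close>

lemma gaussian_shift_symmetric_convex:
  fixes K :: "(real ^ 'n) set"
  assumes K [measurable]: "K \<in> sets borel" and cvx: "convex K" and sym: "\<And>z. - z \<in> K \<longleftrightarrow> z \<in> K"
    and J [measurable]: "J \<in> sets borel" and Jsym: "\<And>s. - s \<in> J \<longleftrightarrow> s \<in> J"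
    and KJ: "\<And>z. z \<in> K \<Longrightarrow> z \<bullet> b \<in> J"
    and b: "b \<in> Basis" and c: "0 \<le> c"
  shows "exp (- c\<^sup>2 / 2) * measure standard_gaussian K \<le> measure standard_gaussian {z. z - c *\<^sub>R b \<in> K}"
    and "measure standard_gaussian {z. z - c *\<^sub>R b \<in> K} * measure gauss1 J
       \<le> measure standard_gaussian K * measure gauss1 {s. s - c \<in> J}"
proof -
  interpret prob_space "standard_gaussian :: (real ^ 'n) measure" by (rule prob_space_standard_gaussian)
  let ?G = "standard_gaussian :: (real ^ 'n) measure"
  have nb: "norm b = 1" using b by simp
  define C where "C = (\<lambda>z. cosh (c * (z \<bullet> b)))"
  have [measurable]: "C \<in> borel_measurable borel"
    unfolding C_def cosh_def by measurable
  have C1: "1 \<le> C z" for z unfolding C_def by (rule cosh_real_ge_1)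
  have shift: "measure ?G {z. z - c *\<^sub>R b \<in> S} = exp (- c\<^sup>2 / 2) * (\<integral>z. indicator S z * C z \<partial>?G)"
    and Cint: "integrable ?G (\<lambda>z. indicator S z * C z)"
    if "S \<in> sets borel" "\<And>z. - z \<in> S \<longleftrightarrow> z \<in> S" for S
    unfolding C_def by (rule measure_gaussian_shift integrable_cosh_gaussian, fact, fact, fact)+
  have i0: "integrable ?G (\<lambda>z. indicator S z :: real)" if "S \<in> sets borel" for S
    by (rule integrable_const_bound[where B=1]) (use that in auto)
  define IK where "IK = (\<integral>z. indicator K z * C z \<partial>?G)"
  have shK: "measure ?G {z. z - c *\<^sub>R b \<in> K} = exp (- c\<^sup>2 / 2) * IK"
    unfolding IK_def using shift[OF K sym] .
  have "measure ?G K = (\<integral>z. indicator K z \<partial>?G)" by simp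
  also have "\<dots> \<le> IK" unfolding IK_def
    using C1 by (intro integral_mono i0[OF K] Cint[OF K sym]) (auto simp: indicator_def)
  finally show "exp (- c\<^sup>2 / 2) * measure ?G K \<le> measure ?G {z. z - c *\<^sub>R b \<in> K}"
    unfolding shK by (intro mult_left_mono) auto
  define T where "T = {z :: real ^ 'n. z \<bullet> b \<in> J}"
  have T [measurable]: "T \<in> sets borel" unfolding T_def by measurable
  have Tsym: "- z \<in> T \<longleftrightarrow> z \<in> T" for z using Jsym by (simp add: T_def)
  have proj: "measure ?G {z. z \<bullet> b \<in> A} = measure gauss1 A" if "A \<in> sets borel" for A
    using that by (subst distr_standard_gaussian_component[OF b, symmetric]) (subst measure_distr; auto simp: vimage_def)
  have mJ: "measure gauss1 J = measure ?G T" unfolding T_def using proj[OF J] by simp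
  have sJ [measurable]: "{s. s - c \<in> J} \<in> sets borel" by measurable
  define IT where "IT = (\<integral>z. indicator T z * C z \<partial>?G)"
  have "measure gauss1 {s. s - c \<in> J} = measure ?G {z. z - c *\<^sub>R b \<in> T}"
    using proj[OF sJ] b by (simp add: T_def inner_diff_left)
  then have mJc: "measure gauss1 {s. s - c \<in> J} = exp (- c\<^sup>2 / 2) * IT"
    unfolding IT_def using shift[OF T Tsym] by simp
  have main: "IK * measure ?G T \<le> measure ?G K * IT"
  proof (cases "c = 0 \<or> measure ?G T = 0")
    case True
    have IKnn: "0 \<le> IT" unfolding IT_def using order_trans[OF zero_le_one C1]
      by (intro Bochner_Integration.integral_nonneg) simp
    show ?thesis
    proof (cases "c = 0")
      case True then show ?thesis by (simp add: IK_def IT_def C_def)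
    next
      case False with \<open>c = 0 \<or> _\<close> IKnn show ?thesis by simp
    qed
  next
    case False
    then have c0: "0 < c" and Tpos: "0 < measure ?G T" using c by (auto simp: zero_less_measure_iff)
    define m where "m = IT / measure ?G T"
    have "measure ?G T = (\<integral>z. indicator T z \<partial>?G)" by simp
    also have "\<dots> \<le> IT" unfolding IT_def
      using C1 by (intro integral_mono i0[OF T] Cint[OF T Tsym]) (auto simp: indicator_def)
    finally have m: "1 \<le> m" using Tpos by (simp add: m_def)
    \<comment> \<open>The mean \<open>m\<close> is at least 1, hence a value of the hyperbolic cosine.\<close>
    define s0 where "s0 = arcosh m / c"
    have s0: "0 \<le> s0" "cosh (c * s0) = m"
      using c0 m by (simp_all add: s0_def)
    obtain G where G [measurable]: "G \<in> borel_measurable borel" and lc: "log_concave G"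
      and le1: "\<And>z. G z \<le> 1" and ev: "\<And>z. G (- z) = G z"
      and inv: "\<And>d z c. d \<in> Basis - {b} \<Longrightarrow> G (z + c *\<^sub>R d) = G z"
      and int: "\<And>h. h \<in> borel_measurable borel \<Longrightarrow>
         (\<integral>\<^sup>+z. ennreal (indicator K z) * h (z \<bullet> b) \<partial>?G) = (\<integral>\<^sup>+z. ennreal (G z) * h (z \<bullet> b) \<partial>?G)"
      using log_concave_even_marginal_exists[of "indicator K" b "Basis - {b}"]
        log_concave_indicator_convex[OF cvx] sym b K by (auto simp: indicator_def)
    note Gnn = log_concaveD(1)[OF lc]
    have fold: "(\<integral>z. indicator K z * h (z \<bullet> b) \<partial>?G) = (\<integral>z. indicator T z * G z * h (z \<bullet> b) \<partial>?G)"
      if [measurable]: "h \<in> borel_measurable borel" and nn: "\<And>s. 0 \<le> h s" for h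
    proof -
      have "(\<integral>\<^sup>+z. ennreal (indicator K z * h (z \<bullet> b)) \<partial>?G)
          = (\<integral>\<^sup>+z. ennreal (indicator K z) * ennreal (indicator J (z \<bullet> b) * h (z \<bullet> b)) \<partial>?G)"
        using KJ by (intro nn_integral_cong) (auto simp: indicator_def)
      also have "\<dots> = (\<integral>\<^sup>+z. ennreal (G z) * ennreal (indicator J (z \<bullet> b) * h (z \<bullet> b)) \<partial>?G)"
        by (rule int) measurable
      also have "\<dots> = (\<integral>\<^sup>+z. ennreal (indicator T z * G z * h (z \<bullet> b)) \<partial>?G)"
        using Gnn nn by (intro nn_integral_cong) (auto simp: indicator_def T_def ennreal_mult)
      finally show ?thesis using Gnn nn by (simp add: integral_eq_nn_integral)
    qed
    have IK: "IK = (\<integral>z. indicator T z * G z * C z \<partial>?G)"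
      unfolding IK_def C_def by (rule fold[of "\<lambda>s. cosh (c * s)"]) (auto simp: cosh_def)
    have mK: "measure ?G K = (\<integral>z. indicator T z * G z \<partial>?G)"
      using fold[of "\<lambda>_. 1"] by simp
    have i1: "integrable ?G (\<lambda>z. indicator T z * C z)" by (rule Cint[OF T Tsym])
    have i2: "integrable ?G (\<lambda>z. indicator T z * G z * C z)"
      by (rule Bochner_Integration.integrable_bound[OF i1])
         (use Gnn le1 C1 in \<open>auto intro!: AE_I2 mult_left_le_one_le simp: indicator_def abs_mult\<close>)
    have i3: "integrable ?G (\<lambda>z. indicator T z * G z)"
      by (rule integrable_const_bound[where B=1]) (use Gnn le1 in \<open>auto simp: indicator_def\<close>)
    have i4: "integrable ?G (\<lambda>z. indicator T z :: real)" by (rule i0[OF T])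
    define g0 where "g0 = G (s0 *\<^sub>R b)"
    have le0: "indicator T z * ((G z - g0) * (C z - m)) \<le> 0" for z
    proof -
      have Gz: "G z = G ((z \<bullet> b) *\<^sub>R b)" by (rule translation_invariant_eq_component[OF b inv])
      have "(G z - g0) * (C z - m) \<le> 0"
      proof (cases "s0 \<le> \<bar>z \<bullet> b\<bar>")
        case True
        then have "G z \<le> g0" unfolding Gz g0_def using s0 by (intro log_concave_even_antimono[OF lc ev]) auto
        moreover have "m \<le> C z" using True c0 s0 cosh_mult_le_iff[of c s0 "z \<bullet> b"] by (simp add: C_def)
        ultimately show ?thesis by (simp add: mult_nonpos_nonneg)
      next
        case False
        then have "g0 \<le> G z" unfolding Gz g0_def using s0 by (intro log_concave_even_antimono[OF lc ev]) auto
        moreover have "C z \<le> m" using False c0 s0 cosh_mult_le_iff[of c s0 "z \<bullet> b"] by (simp add: C_def)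
        ultimately show ?thesis by (simp add: mult_nonneg_nonpos)
      qed
      then show ?thesis by (simp add: indicator_def)
    qed
    have "(\<integral>z. indicator T z * ((G z - g0) * (C z - m)) \<partial>?G) \<le> 0"
    proof -
      have "0 \<le> (\<integral>z. - (indicator T z * ((G z - g0) * (C z - m))) \<partial>?G)"
        using le0 by (intro Bochner_Integration.integral_nonneg) simp
      then show ?thesis by simp
    qed
    also have "(\<lambda>z. indicator T z * ((G z - g0) * (C z - m)))
        = (\<lambda>z. indicator T z * G z * C z - m * (indicator T z * G z) - (g0 * (indicator T z * C z) - g0 * m * indicator T z))"
      by (auto simp: algebra_simps)
    also have "(\<integral>z. \<dots> z \<partial>?G) = IK - m * measure ?G K - (g0 * IT - g0 * m * measure ?G T)"
      using i1 i2 i3 i4 by (simp add: IK mK IT_def)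
    also have "g0 * m * measure ?G T = g0 * IT" using Tpos by (simp add: m_def)
    finally have "IK \<le> m * measure ?G K" by simp
    then show ?thesis using Tpos by (simp add: m_def field_simps)
  qed
  have "exp (- c\<^sup>2 / 2) * (IK * measure ?G T) \<le> exp (- c\<^sup>2 / 2) * (measure ?G K * IT)"
    using main by (intro mult_left_mono) auto
  then show "measure ?G {z. z - c *\<^sub>R b \<in> K} * measure gauss1 J
       \<le> measure ?G K * measure gauss1 {s. s - c \<in> J}"
    unfolding shK mJ mJc by (simp only: ac_simps)
qed

section \<open>Translates of even unimodal functions\<close>

lemma null_set_gaussian_negligible:
  fixes N :: "(real ^ 'n) set"
  assumes N: "N \<in> sets borel" and neg: "negligible N"
  shows "emeasure standard_gaussian N = 0"
proof -
  have "emeasure lborel N = 0"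
    using neg N by (simp add: negligible_iff_null_sets null_sets_def)
  then have "N \<in> null_sets lborel" using N by (simp add: null_sets_def)
  then show ?thesis unfolding standard_gaussian_def
    using N by (subst emeasure_density) (auto intro: nn_integral_null_set)
qed

text \<open>
  A convex set need not be Borel, but it differs from its interior by a part of its frontier, which
  is a Lebesgue null set. This is why unimodal functions of \<open>Y\<close> are measurable for the completion.
\<close>

lemma
  fixes Y :: "'s \<Rightarrow> real ^ 'n"
  assumes Y [measurable]: "Y \<in> borel_measurable M" and law: "distr M borel Y = standard_gaussian"
    and K: "convex K"
  shows sets_completion_convex_event: "{\<omega> \<in> space M. Y \<omega> \<in> K} \<in> sets (completion M)"
    and emeasure_completion_convex_event:
      "emeasure (completion M) {\<omega> \<in> space M. Y \<omega> \<in> K} = emeasure standard_gaussian (interior K)"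
proof -
  have em: "emeasure M {\<omega> \<in> space M. Y \<omega> \<in> B} = emeasure standard_gaussian B" if "B \<in> sets borel" for B
    using that by (simp add: law[symmetric] emeasure_distr vimage_def Int_def conj_commute)
  have [measurable]: "frontier K \<in> sets borel" by simp
  have "{\<omega> \<in> space M. Y \<omega> \<in> frontier K} \<in> sets M" by measurable
  then have fr: "{\<omega> \<in> space M. Y \<omega> \<in> frontier K} \<in> null_sets M"
    using em[of "frontier K"] null_set_gaussian_negligible[of "frontier K"] negligible_convex_frontier[OF K]
    by (auto simp: null_sets_def)
  have sub: "{\<omega> \<in> space M. Y \<omega> \<in> K} - {\<omega> \<in> space M. Y \<omega> \<in> interior K} \<subseteq> {\<omega> \<in> space M. Y \<omega> \<in> frontier K}"
    using closure_subset by (auto simp: frontier_def)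
  have [measurable]: "interior K \<in> sets borel" by simp
  have int: "{\<omega> \<in> space M. Y \<omega> \<in> interior K} \<in> sets M" by measurable
  show sets: "{\<omega> \<in> space M. Y \<omega> \<in> K} \<in> sets (completion M)"
    by (rule sets_completionI[OF _ sub fr int]) (use interior_subset in auto)
  have "AE \<omega> in M. Y \<omega> \<notin> frontier K" using AE_not_in[OF fr] by (auto elim: AE_mp)
  then have "AE \<omega> in completion M. Y \<omega> \<notin> frontier K" by (rule AE_completion)
  then have "emeasure (completion M) {\<omega> \<in> space M. Y \<omega> \<in> K}
      = emeasure (completion M) {\<omega> \<in> space M. Y \<omega> \<in> interior K}"
    using sub interior_subset sets int by (intro emeasure_eq_AE) auto
  also have "\<dots> = emeasure standard_gaussian (interior K)"
    using em[of "interior K"] int by simp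
  finally show "emeasure (completion M) {\<omega> \<in> space M. Y \<omega> \<in> K} = emeasure standard_gaussian (interior K)" .
qed

text \<open>
  The origin is the midpoint of \<open>z\<close> and \<open>- z\<close>. In particular an even unimodal function is bounded, so
  its expectations are finite.
\<close>

lemma even_unimodal_le_zero:
  assumes "even_fun F" "unimodal F" shows "F z \<le> F 0"
proof (rule ccontr)
  assume "\<not> ?thesis"
  then have "z \<in> {x. F x > F 0}" "- z \<in> {x. F x > F 0}" using assms(1) by (auto simp: even_fun_def)
  moreover have "convex {x. F x > F 0}" using assms(2) by (simp add: unimodal_def)
  ultimately have "(1/2) *\<^sub>R z + (1/2) *\<^sub>R (- z) \<in> {x. F x > F 0}"
    by (intro convexD) auto
  then show False by simp
qed

text \<open>
  The inequalities for sets are integrated over the levels \<open>s > 0\<close> of \<open>F\<close>; \<open>K s\<close> is the interior of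
  the level set, and \<open>N v\<close> the resulting layer cake integral for \<open>E v\<close>. The last statement says that
  \<open>F\<close> cannot live on a hyperplane if its expectation is positive: all \<open>K s\<close> would be empty. It
  excludes the degenerate slab of width zero.
\<close>

lemma gaussian_shift_even_unimodal:
  fixes M :: "'s measure" and Y :: "'s \<Rightarrow> real ^ 'n" and F :: "real ^ 'n \<Rightarrow> real"
  defines "E \<equiv> \<lambda>v. expect M (\<lambda>\<omega>. F (Y \<omega> - v))"
  assumes M: "prob_space M" and Y [measurable]: "Y \<in> borel_measurable M"
    and law: "distr M borel Y = standard_gaussian"
    and nn: "\<And>z. 0 \<le> F z" and ev: "even_fun F" and uni: "unimodal F"
    and b: "b \<in> Basis" and c: "0 \<le> c"
  shows "exp (- c\<^sup>2 / 2) * E 0 \<le> E (c *\<^sub>R b)"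
    and "\<lbrakk>J \<in> sets borel; \<And>s. - s \<in> J \<longleftrightarrow> s \<in> J; \<And>z. 0 < F z \<Longrightarrow> z \<bullet> b \<in> J\<rbrakk>
      \<Longrightarrow> E (c *\<^sub>R b) * measure gauss1 J \<le> E 0 * measure gauss1 {s. s - c \<in> J}"
    and "0 < E 0 \<Longrightarrow> \<exists>z. 0 < F z \<and> z \<bullet> b \<noteq> 0"
proof -
  interpret prob_space M by (rule M)
  interpret C: prob_space "completion M"
    by (rule prob_spaceI) (simp add: emeasure_space_1)
  interpret G: prob_space "standard_gaussian :: (real ^ 'n) measure" by (rule prob_space_standard_gaussian)
  define K where "K = (\<lambda>s. interior {z. s < F z})"
  have Kcvx: "convex (K s)" and Kmeas [measurable]: "K s \<in> sets borel" for s
    using uni by (auto simp: K_def unimodal_def)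
  have Ksym: "- z \<in> K s \<longleftrightarrow> z \<in> K s" for s z
  proof -
    have "uminus ` {z. s < F z} = {z. s < F z}"
      using ev by (auto simp: even_fun_def image_iff) (metis minus_minus)
    then have "uminus ` K s = K s" unfolding K_def by (metis interior_negations)
    then show ?thesis by (metis imageI minus_minus)
  qed
  have KF: "s < F z" if "z \<in> K s" for s z using that interior_subset by (auto simp: K_def)
  have event: "{\<omega> \<in> space M. s < F (Y \<omega> - v)} \<in> sets (completion M)"
    "emeasure (completion M) {\<omega> \<in> space M. s < F (Y \<omega> - v)} = emeasure standard_gaussian {z. z - v \<in> K s}" for s v
  proof -
    have cvx: "convex ((+) v ` {z. s < F z})" using uni by (simp add: unimodal_def convex_translation)
    have tr: "(+) v ` A = {z. z - v \<in> A}" for A :: "(real ^ 'n) set" by (auto simp: image_iff algebra_simps) (metis add_diff_cancel_left' add.commute diff_add_cancel)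
    have "{\<omega> \<in> space M. s < F (Y \<omega> - v)} = {\<omega> \<in> space M. Y \<omega> \<in> (+) v ` {z. s < F z}}" by (simp add: tr)
    moreover have "interior ((+) v ` {z. s < F z}) = {z. z - v \<in> K s}"
      unfolding interior_translation K_def by (rule tr)
    ultimately show "{\<omega> \<in> space M. s < F (Y \<omega> - v)} \<in> sets (completion M)"
      "emeasure (completion M) {\<omega> \<in> space M. s < F (Y \<omega> - v)} = emeasure standard_gaussian {z. z - v \<in> K s}"
      using sets_completion_convex_event[OF Y law cvx] emeasure_completion_convex_event[OF Y law cvx] by simp_all
  qed
  have meas: "(\<lambda>\<omega>. F (Y \<omega> - v)) \<in> borel_measurable (completion M)" for v
    unfolding borel_measurable_iff_greater using event(1) by simp
  have int: "integrable (completion M) (\<lambda>\<omega>. F (Y \<omega> - v))" for v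
    using even_unimodal_le_zero[OF ev uni] nn meas
    by (intro C.integrable_const_bound[where B="F 0"]) auto
  define N where "N = (\<lambda>v. \<integral>\<^sup>+s. emeasure standard_gaussian {z. z - v \<in> K s} * indicator {0<..} s \<partial>lborel)"
  have N: "N v = ennreal (E v)" for v
  proof -
    have "ennreal (E v) = (\<integral>\<^sup>+\<omega>. ennreal (F (Y \<omega> - v)) \<partial>completion M)"
      unfolding E_def expect_def using int nn by (subst nn_integral_eq_integral) auto
    also have "\<dots> = (\<integral>\<^sup>+s. emeasure (completion M) {\<omega> \<in> space (completion M). s < F (Y \<omega> - v)} * indicator {0<..} s \<partial>lborel)"
      by (rule nn_integral_layer_cake[OF C.sigma_finite_measure_axioms meas nn])
    also have "\<dots> = N v" by (simp add: N_def event(2))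
    finally show ?thesis ..
  qed
  have Emeas: "(\<lambda>s. emeasure standard_gaussian {z. z - v \<in> K s} * indicator {0<..} s) \<in> borel_measurable lborel" for v
  proof -
    have "(\<lambda>s. emeasure (completion M) {\<omega> \<in> space (completion M). s < F (Y \<omega> - v)}) \<in> borel_measurable borel"
      by (rule borel_measurable_upper_tail[OF C.sigma_finite_measure_axioms meas])
    then show ?thesis by (simp add: event(2))
  qed
  have Enn: "0 \<le> E v" for v unfolding E_def expect_def using nn by (intro Bochner_Integration.integral_nonneg) auto
  have "ennreal (exp (- c\<^sup>2 / 2)) * N 0 \<le> N (c *\<^sub>R b)"
    unfolding N_def
  proof (subst nn_integral_cmult[symmetric], rule Emeas, rule nn_integral_mono)
    fix s :: real
    have "exp (- c\<^sup>2 / 2) * measure standard_gaussian (K s) \<le> measure standard_gaussian {z. z - c *\<^sub>R b \<in> K s}"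
      by (rule gaussian_shift_symmetric_convex(1)[OF Kmeas Kcvx Ksym _ _ _ b c, of UNIV]) auto
    then show "ennreal (exp (- c\<^sup>2 / 2)) * (emeasure standard_gaussian {z. z - 0 \<in> K s} * indicator {0<..} s)
        \<le> emeasure standard_gaussian {z. z - c *\<^sub>R b \<in> K s} * indicator {0<..} s"
      by (auto simp: G.emeasure_eq_measure ennreal_mult[symmetric] indicator_def)
  qed
  then show "exp (- c\<^sup>2 / 2) * E 0 \<le> E (c *\<^sub>R b)"
    using Enn by (simp add: N ennreal_mult[symmetric])
  show "E (c *\<^sub>R b) * measure gauss1 J \<le> E 0 * measure gauss1 {s. s - c \<in> J}"
    if J: "J \<in> sets borel" and Jsym: "\<And>s. - s \<in> J \<longleftrightarrow> s \<in> J" and FJ: "\<And>z. 0 < F z \<Longrightarrow> z \<bullet> b \<in> J"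
  proof -
    have "N (c *\<^sub>R b) * ennreal (measure gauss1 J) \<le> N 0 * ennreal (measure gauss1 {s. s - c \<in> J})"
      unfolding N_def
    proof (subst (1 2) nn_integral_multc[symmetric], rule Emeas, rule Emeas, rule nn_integral_mono)
      fix s :: real
      have "measure standard_gaussian {z. z - c *\<^sub>R b \<in> K s} * measure gauss1 J
          \<le> measure standard_gaussian (K s) * measure gauss1 {s. s - c \<in> J}" if "0 < s"
        by (rule gaussian_shift_symmetric_convex(2)[OF Kmeas Kcvx Ksym J Jsym _ b c])
           (use FJ KF that in \<open>auto intro: less_trans\<close>)
      then show "emeasure standard_gaussian {z. z - c *\<^sub>R b \<in> K s} * indicator {0<..} s * ennreal (measure gauss1 J)
          \<le> emeasure standard_gaussian {z. z - 0 \<in> K s} * indicator {0<..} s * ennreal (measure gauss1 {s. s - c \<in> J})"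
        by (auto simp: G.emeasure_eq_measure ennreal_mult[symmetric] indicator_def)
    qed
    then show ?thesis using Enn by (simp add: N ennreal_mult[symmetric])
  qed
  show "\<exists>z. 0 < F z \<and> z \<bullet> b \<noteq> 0" if "0 < E 0"
  proof (rule ccontr)
    assume no: "\<not> ?thesis"
    have "K s = {}" if "0 < s" for s
    proof -
      have "{z. s < F z} \<subseteq> {z. b \<bullet> z = 0}" using no that by (force simp: inner_commute)
      then have "K s \<subseteq> interior {z. b \<bullet> z = 0}" unfolding K_def by (rule interior_mono)
      moreover have "interior {z. b \<bullet> z = 0} = {}" using b nonzero_Basis by (intro interior_hyperplane) blast
      ultimately show ?thesis by blast
    qed
    then have "N 0 = (\<integral>\<^sup>+s. 0 \<partial>(lborel :: real measure))"
      unfolding N_def by (intro nn_integral_cong) (auto simp: indicator_def)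
    then show False using that by (simp add: N)
  qed
qed

section \<open>The normal distribution of an interval and of its translates\<close>

lemma measure_gauss1_interval:
  assumes "x < y" shows "measure gauss1 {x..y} = Phi y - Phi x"
proof -
  interpret real_distribution gauss1 by (rule real_dist_normal_dist)
  have "{x} \<in> null_sets lborel" by (simp add: null_sets_def)
  then have "emeasure gauss1 {x} = 0"
    by (subst emeasure_density) (auto intro: nn_integral_null_set)
  then have "measure gauss1 {x} = 0" by (simp add: measure_def)
  then have "measure gauss1 ({x} \<union> {x<..y}) = measure gauss1 {x<..y}"
    by (subst finite_measure_Union) auto
  also have "{x} \<union> {x<..y} = {x..y}" using assms by auto
  finally show ?thesis unfolding Phi_def using cdf_diff_eq[OF assms] by simp
qed

lemma measure_gauss1_interval_pos:
  assumes "0 < a" shows "0 < measure gauss1 {- a..a}"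
proof (rule ccontr)
  interpret prob_space gauss1 by (rule prob_space_gauss1)
  assume "\<not> ?thesis"
  then have "emeasure gauss1 {- a..a} = 0"
    by (simp add: emeasure_eq_measure zero_less_measure_iff)
  then have "{- a..a} \<in> null_sets gauss1" by (simp add: null_sets_def)
  then have "AE x in lborel. x \<notin> {- a..a}"
    by (subst (asm) null_sets_density_iff) (auto simp: normal_density_pos less_imp_neq[symmetric] elim!: AE_mp)
  then have "emeasure lborel {- a..a} = 0" by (subst (asm) AE_iff_null_sets[symmetric]) auto
  then show False using assms by simp
qed

text \<open>
  The bound for symmetric convex sets with \<open>J = UNIV\<close>, applied to an interval in dimension one.
\<close>

lemma measure_gauss1_shift_le:
  assumes "0 \<le> c"
  shows "measure gauss1 {s. s - c \<in> {- a..a}} \<le> measure gauss1 {- a..a}"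
proof -
  interpret prob_space gauss1 by (rule prob_space_gauss1)
  define b :: "real ^ 1" where "b = axis 1 1"
  have b: "b \<in> Basis" by (simp add: b_def)
  have proj: "measure standard_gaussian {z. z \<bullet> b \<in> A} = measure gauss1 A" if "A \<in> sets borel" for A
    using that by (subst distr_standard_gaussian_component[OF b, symmetric]) (subst measure_distr; auto simp: vimage_def)
  have "convex {z. z \<bullet> b \<in> {- a..a}}"
    using convex_Int[OF convex_halfspace_ge[where a=b and b="- a"] convex_halfspace_le[where a=b and b=a]]
    by (simp add: Int_def inner_commute)
  then have "measure standard_gaussian {z. z - c *\<^sub>R b \<in> {z. z \<bullet> b \<in> {- a..a}}} * measure gauss1 UNIV
      \<le> measure standard_gaussian {z. z \<bullet> b \<in> {- a..a}} * measure gauss1 {s. s - c \<in> UNIV}"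
    by (intro gaussian_shift_symmetric_convex(2) b assms) auto
  moreover have "measure gauss1 UNIV = 1" using prob_space by simp
  moreover have "{z. z - c *\<^sub>R b \<in> {z. z \<bullet> b \<in> {- a..a}}} = {z. z \<bullet> b \<in> {s. s - c \<in> {- a..a}}}"
    using b by (simp add: inner_diff_left)
  ultimately show ?thesis using proj[of "{s. s - c \<in> {- a..a}}"] proj[of "{- a..a}"] by simp
qed

section \<open>Moments of a Gaussian vector\<close>

lemma
  fixes b c :: "real ^ 'n"
  assumes b: "b \<in> Basis" and c: "c \<in> Basis"
  shows integrable_gaussian_component: "integrable standard_gaussian (\<lambda>z. z \<bullet> b)"
    and integral_gaussian_component: "(\<integral>z. z \<bullet> b \<partial>standard_gaussian) = 0"
    and integrable_gaussian_component_product: "integrable standard_gaussian (\<lambda>z. (z \<bullet> b) * (z \<bullet> c))"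
    and integral_gaussian_component_product:
      "(\<integral>z. (z \<bullet> b) * (z \<bullet> c) \<partial>standard_gaussian) = (if b = c then 1 else 0)"
proof -
  interpret P: prob_space gauss1 by (rule prob_space_gauss1)
  interpret G: product_sigma_finite "\<lambda>_. gauss1" ..
  let ?B = "Basis :: (real ^ 'n) set"
  let ?s = "\<lambda>g. \<Sum>b\<in>?B. g b *\<^sub>R b"
  have i1: "integrable gauss1 (\<lambda>x. x)" using integrable_std_normal_distribution_moment[of 1] by simp
  have e1: "(\<integral>x. x \<partial>gauss1) = 0" using integral_std_normal_distribution_moment_odd[of 1] by simp
  have i2: "integrable gauss1 (\<lambda>x. x * x)"
    using integrable_std_normal_distribution_moment[of 2] by (simp add: power2_eq_square)
  have e2: "(\<integral>x. x * x \<partial>gauss1) = 1"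
    using std_normal_distribution_even_moments(1)[of 1] by (simp add: power2_eq_square)
  have di: "integrable standard_gaussian (\<lambda>z. h (z \<bullet> b)) \<longleftrightarrow> integrable gauss1 h"
    and de: "(\<integral>z. h (z \<bullet> b) \<partial>standard_gaussian) = (\<integral>x. h x \<partial>gauss1)"
    if [measurable]: "h \<in> borel_measurable borel" for h :: "real \<Rightarrow> real"
    using integrable_distr_eq[of "\<lambda>z. z \<bullet> b" standard_gaussian borel h]
      integral_distr[of "\<lambda>z. z \<bullet> b" standard_gaussian borel h]
    unfolding distr_standard_gaussian_component[OF b] by simp_all
  have m1: "(\<lambda>x::real. x) \<in> borel_measurable borel" by simp
  show "integrable standard_gaussian (\<lambda>z. z \<bullet> b)" "(\<integral>z. z \<bullet> b \<partial>standard_gaussian) = 0"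
    using di[OF m1, THEN iffD2, OF i1] trans[OF de[OF m1] e1] by blast+
  define f where "f = (\<lambda>d x :: real. (if d = b then x else 1) * (if d = c then x else 1))"
  have fprod: "(\<Prod>d\<in>?B. f d (g d)) = g b * g c" for g
    unfolding f_def prod.distrib using b c by simp
  have fcase: "f d = (if d = b then if d = c then (\<lambda>x. x * x) else (\<lambda>x. x) else if d = c then (\<lambda>x. x) else (\<lambda>x. 1))" for d
    unfolding f_def by simp
  have one: "integrable gauss1 (\<lambda>x. 1 :: real)" "(\<integral>x. 1 \<partial>gauss1) = (1 :: real)"
    using P.prob_space by simp_all
  have fi: "integrable gauss1 (f d)" for d
    unfolding fcase using i1 i2 one by (simp only: if_split) blast
  have fe: "(\<integral>x. f d x \<partial>gauss1) = (if d = b then if d = c then 1 else 0 else if d = c then 0 else 1)" for d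
    unfolding fcase using e1 e2 one by (simp only: split: if_split) blast
  have pi: "integrable (Pi\<^sub>M ?B (\<lambda>_. gauss1)) (\<lambda>g. g b * g c)"
    using G.product_integrable_prod[of ?B f, OF finite_Basis fi] unfolding fprod .
  have pe: "(\<integral>g. g b * g c \<partial>Pi\<^sub>M ?B (\<lambda>_. gauss1)) = (if b = c then 1 else 0)"
  proof -
    have "(\<integral>g. g b * g c \<partial>Pi\<^sub>M ?B (\<lambda>_. gauss1)) = (\<Prod>d\<in>?B. \<integral>x. f d x \<partial>gauss1)"
      using G.product_integral_prod[of ?B f, OF finite_Basis fi] unfolding fprod .
    also have "\<dots> = (if b = c then 1 else 0)"
    proof (cases "b = c")
      case True then show ?thesis by (auto simp: fe intro!: prod.neutral)
    next
      case False
      then have "\<exists>d\<in>?B. (\<integral>x. f d x \<partial>gauss1) = 0" using b by (auto simp: fe)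
      then show ?thesis using False by (simp add: prod_zero)
    qed
    finally show ?thesis .
  qed
  have comp: "?s g \<bullet> b = g b" "?s g \<bullet> c = g c" for g using b c by simp_all
  show "integrable standard_gaussian (\<lambda>z. (z \<bullet> b) * (z \<bullet> c))"
    unfolding standard_gaussian_eq_distr_PiM
    by (subst integrable_distr_eq) (use pi in \<open>simp_all add: comp\<close>)
  show "(\<integral>z. (z \<bullet> b) * (z \<bullet> c) \<partial>standard_gaussian) = (if b = c then 1 else 0)"
    unfolding standard_gaussian_eq_distr_PiM
    by (subst integral_distr) (use pe in \<open>simp_all add: comp\<close>)
qed

text \<open>
  The law of the affine image determines both moments: by linearity they reduce to the first and
  second moments of the coordinates.
\<close>

lemma gaussian_vector_moments:
  fixes m :: "real ^ 'n" and A :: "real ^ 'n ^ 'n"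
  assumes X [measurable]: "X \<in> borel_measurable M"
    and law: "distr M borel X = distr standard_gaussian borel (\<lambda>z. m + A *v z)"
  shows "mean_vector M X = m" "covariance_matrix M X = A ** transpose A"
proof -
  interpret prob_space "standard_gaussian :: (real ^ 'n) measure" by (rule prob_space_standard_gaussian)
  let ?G = "standard_gaussian :: (real ^ 'n) measure"
  have ax: "axis i (1::real) \<in> Basis" for i :: 'n by simp
  have comp: "z $ i = z \<bullet> axis i 1" for z :: "real ^ 'n" and i by (simp add: inner_axis)
  have i1: "integrable ?G (\<lambda>z. z $ i)" "(\<integral>z. z $ i \<partial>?G) = 0" for i
    unfolding comp by (rule integrable_gaussian_component integral_gaussian_component; fact ax)+
  have i2: "integrable ?G (\<lambda>z. z $ i * z $ j)" "(\<integral>z. z $ i * z $ j \<partial>?G) = (if i = j then 1 else 0)" for i j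
    unfolding comp using integrable_gaussian_component_product[OF ax ax, of i j]
      integral_gaussian_component_product[OF ax ax, of i j] by (simp_all add: axis_eq_axis)
  have lin: "bounded_linear ((*v) A)" by (rule matrix_vector_mul_bounded_linear)
  have [measurable]: "(*v) A \<in> borel_measurable borel"
    by (intro borel_measurable_continuous_onI linear_continuous_on lin)
  have iz: "integrable ?G (\<lambda>z. z)"
    by (rule Bochner_Integration.integrable_bound[of _ "\<lambda>z. \<Sum>i\<in>UNIV. \<bar>z $ i\<bar>"])
       (use i1 in \<open>auto intro!: AE_I2 norm_le_l1_cart order_trans[OF _ abs_ge_self]\<close>)
  have ez: "(\<integral>z. z \<partial>?G) = 0"
    by (simp add: vec_eq_iff integral_bounded_linear[OF bounded_linear_vec_nth iz, symmetric] i1)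
  have tr: "(\<integral>\<omega>. h (X \<omega>) \<partial>M) = (\<integral>z. h (m + A *v z) \<partial>?G)"
    if [measurable]: "h \<in> borel_measurable borel" for h :: "real ^ 'n \<Rightarrow> 'b::{banach, second_countable_topology}"
  proof -
    have "(\<integral>\<omega>. h (X \<omega>) \<partial>M) = (\<integral>x. h x \<partial>distr M borel X)" by (simp add: integral_distr)
    also have "\<dots> = (\<integral>z. h (m + A *v z) \<partial>?G)" unfolding law by (subst integral_distr) auto
    finally show ?thesis .
  qed
  have "mean_vector M X = (\<integral>z. m + A *v z \<partial>?G)"
    unfolding mean_vector_def using tr[of "\<lambda>x. x"] by simp
  also have "\<dots> = m + (\<integral>z. A *v z \<partial>?G)"
    using integrable_bounded_linear[OF lin iz] prob_space by (subst Bochner_Integration.integral_add) auto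
  also have "(\<integral>z. A *v z \<partial>?G) = 0"
    using integral_bounded_linear[OF lin iz] by (simp add: ez)
  finally show mean: "mean_vector M X = m" by simp
  show "covariance_matrix M X = A ** transpose A"
    unfolding vec_eq_iff
  proof (intro allI)
    fix i j
    have "covariance_matrix M X $ i $ j = (\<integral>\<omega>. (X \<omega> $ i - m $ i) * (X \<omega> $ j - m $ j) \<partial>M)"
      by (simp add: covariance_matrix_def mean)
    also have "\<dots> = (\<integral>z. (A *v z) $ i * (A *v z) $ j \<partial>?G)"
      using tr[of "\<lambda>x. (x $ i - m $ i) * (x $ j - m $ j)"] by simp
    also have "\<dots> = (\<integral>z. (\<Sum>k\<in>UNIV. \<Sum>l\<in>UNIV. A $ i $ k * A $ j $ l * (z $ k * z $ l)) \<partial>?G)"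
      by (simp add: matrix_vector_mult_def sum_product ac_simps)
    also have "\<dots> = (\<Sum>k\<in>UNIV. \<Sum>l\<in>UNIV. A $ i $ k * A $ j $ l * (if k = l then 1 else 0))"
      by (simp add: Bochner_Integration.integral_sum i2)
    also have "\<dots> = (A ** transpose A) $ i $ j"
      by (simp add: matrix_matrix_mult_def transpose_def mult_delta_right)
    finally show "covariance_matrix M X $ i $ j = (A ** transpose A) $ i $ j" .
  qed
qed

section \<open>The square root of a positive definite matrix\<close>

lemma symmetric_matrix_inner:
  fixes B :: "real ^ 'n ^ 'n"
  assumes "transpose B = B" shows "(B *v x) \<bullet> y = x \<bullet> (B *v y)"
  by (metis assms dot_lmul_matrix transpose_matrix_vector)

text \<open>
  The form in which first-order optimality conditions are used below.
\<close>

lemma linear_coefficient_zero: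
  fixes D K :: real
  assumes "\<And>e. 0 \<le> e * D + e\<^sup>2 * K"
  shows "D = 0"
proof (rule ccontr)
  assume D: "D \<noteq> 0"
  define L where "L = \<bar>K\<bar> + 1"
  have L: "L > 0" "K \<le> L" by (auto simp: L_def)
  define e where "e = - D / (2 * L)"
  have "0 \<le> e * D + e\<^sup>2 * K" by (rule assms)
  also have "\<dots> \<le> e * D + e\<^sup>2 * L" using L by (intro add_left_mono mult_left_mono) auto
  also have "\<dots> = - (D\<^sup>2 / (4 * L))" using L by (simp add: e_def power2_eq_square field_simps)
  also have "\<dots> < 0" using D L by simp
  finally show False by simp
qed

lemma posdef_invertible:
  assumes "posdef B" shows "invertible B"
proof -
  have "x = 0" if "B *v x = 0" for x
  proof (rule ccontr)
    assume "x \<noteq> 0"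
    then have "0 < x \<bullet> (B *v x)" using assms by (simp add: posdef_def)
    with that show False by simp
  qed
  then show ?thesis by (simp add: invertible_left_inverse matrix_left_invertible_ker)
qed

lemma posdefI_semidefinite_invertible:
  fixes B :: "real ^ 'n ^ 'n"
  assumes sym: "transpose B = B" and psd: "\<And>x. 0 \<le> x \<bullet> (B *v x)" and inv: "invertible B"
  shows "posdef B"
  unfolding posdef_def
proof (intro conjI sym allI impI)
  fix x :: "real ^ 'n" assume x: "x \<noteq> 0"
  show "0 < x \<bullet> (B *v x)"
  proof (rule ccontr)
    assume "\<not> ?thesis"
    then have 0: "x \<bullet> (B *v x) = 0" using psd[of x] by simp
    define y where "y = B *v x"
    have yx: "x \<bullet> (B *v y) = y \<bullet> y" using symmetric_matrix_inner[OF sym, of x y] by (simp add: y_def)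
    have "0 \<le> e * (2 * (y \<bullet> y)) + e\<^sup>2 * (y \<bullet> (B *v y))" for e
    proof -
      have "(x + e *\<^sub>R y) \<bullet> (B *v (x + e *\<^sub>R y))
          = x \<bullet> (B *v x) + e * (x \<bullet> (B *v y) + y \<bullet> (B *v x)) + e\<^sup>2 * (y \<bullet> (B *v y))"
        by (simp add: matrix_vector_right_distrib matrix_vector_mult_scaleR inner_add_left inner_add_right
            power2_eq_square algebra_simps)
      then show ?thesis using psd[of "x + e *\<^sub>R y"] by (simp add: 0[folded y_def] yx y_def[symmetric])
    qed
    then have "2 * (y \<bullet> y) = 0" by (rule linear_coefficient_zero)
    then have "B *v x = 0" by (simp add: y_def)
    moreover have "\<And>x. B *v x = 0 \<Longrightarrow> x = 0"
      using inv by (simp add: invertible_left_inverse matrix_left_invertible_ker)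
    ultimately show False using x by blast
  qed
qed

text \<open>
  With \<open>D = B - C\<close> one has \<open>D B + C D = B B - C C = 0\<close>. Multiplying by \<open>D\<close> and taking traces, the
  sum of the traces of \<open>D B D\<close> and \<open>D C D\<close> vanishes. These are sums over the rows of \<open>D\<close> of the values
  of two positive definite quadratic forms, so all rows are zero.
\<close>

lemma posdef_square_unique:
  fixes B C :: "real ^ 'n ^ 'n"
  assumes B: "posdef B" and C: "posdef C" and eq: "B ** B = C ** C"
  shows "B = C"
proof -
  define D where "D = B - C"
  have sym: "transpose D = D"
    using B C by (simp add: D_def posdef_def transpose_def vec_eq_iff)
  then have Dij: "D $ i $ j = D $ j $ i" for i j
    by (metis transpose_def vec_lambda_beta)
  have tr: "trace (D ** (E ** D)) = (\<Sum>i\<in>UNIV. D $ i \<bullet> (E *v (D $ i)))" for E :: "real ^ 'n ^ 'n"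
    unfolding trace_def
  proof (intro sum.cong refl)
    fix i
    have "(E ** D) $ k $ i = (E *v (D $ i)) $ k" for k
      by (simp add: matrix_matrix_mult_def matrix_vector_mult_def Dij[of _ i])
    then show "(D ** (E ** D)) $ i $ i = D $ i \<bullet> (E *v (D $ i))"
      by (simp add: matrix_matrix_mult_def[of D] inner_vec_def)
  qed
  have "trace (D ** (B ** D)) + trace (D ** (C ** D)) = trace (D ** (D ** B)) + trace (D ** (C ** D))"
    using trace_mul_sym[of D "D ** B"] by (simp add: matrix_mul_assoc)
  also have "\<dots> = trace (D ** (D ** B + C ** D))" by (simp add: trace_add matrix_add_ldistrib)
  also have "D ** B + C ** D = 0"
  proof -
    have "D ** B = B ** B - C ** B" "C ** D = C ** B - C ** C"
      by (simp_all add: D_def vec_eq_iff matrix_matrix_mult_def left_diff_distrib right_diff_distrib sum_subtractf)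
    then show ?thesis by (simp add: eq)
  qed
  also have "trace (D ** 0) = 0" by (simp add: trace_def matrix_matrix_mult_def)
  finally have sum0: "(\<Sum>i\<in>UNIV. D $ i \<bullet> (B *v (D $ i)) + D $ i \<bullet> (C *v (D $ i))) = 0"
    by (simp add: tr sum.distrib)
  have nn: "0 \<le> x \<bullet> (B *v x)" "0 \<le> x \<bullet> (C *v x)" for x
    using B C by (cases "x = 0"; force simp: posdef_def intro: less_imp_le)+
  have "D $ i = 0" for i
  proof (rule ccontr)
    assume "D $ i \<noteq> 0"
    then have "0 < D $ i \<bullet> (B *v (D $ i))" using B by (simp add: posdef_def)
    moreover have "D $ i \<bullet> (B *v (D $ i)) + D $ i \<bullet> (C *v (D $ i)) = 0"
      using sum0 nn by (subst (asm) sum_nonneg_eq_0_iff) (auto intro: add_nonneg_nonneg)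
    ultimately show False using nn(2)[of "D $ i"] by linarith
  qed
  then show ?thesis by (simp add: D_def vec_eq_iff)
qed

lemma compact_orthogonal_matrices: "compact {Q :: real ^ 'n ^ 'n. orthogonal_matrix Q}"
proof -
  have row: "row i Q = Q $ i" for i and Q :: "real ^ 'n ^ 'n" by (simp add: row_def)
  have "{Q :: real ^ 'n ^ 'n. orthogonal_matrix Q}
      = {Q. \<forall>i j. Q $ i \<bullet> Q $ j = (if i = j then 1 else 0)}"
    unfolding orthogonal_matrix_orthonormal_rows row norm_eq_1 orthogonal_def by auto
  moreover have "closed {Q :: real ^ 'n ^ 'n. \<forall>i j. Q $ i \<bullet> Q $ j = (if i = j then 1 else 0)}"
    by (intro closed_Collect_all closed_Collect_eq continuous_intros)
  moreover have "bounded {Q :: real ^ 'n ^ 'n. orthogonal_matrix Q}"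
    unfolding bounded_iff
  proof (intro exI ballI)
    fix Q :: "real ^ 'n ^ 'n" assume "Q \<in> {Q. orthogonal_matrix Q}"
    then have "norm (Q $ i) = 1" for i by (simp add: orthogonal_matrix_orthonormal_rows row)
    then show "norm Q \<le> CARD('n)"
      using L2_set_le_sum[of UNIV "\<lambda>i. norm (Q $ i)"] by (simp add: norm_vec_def)
  qed
  ultimately show ?thesis by (simp add: compact_eq_bounded_closed)
qed

text \<open>
  The left side is the trace of \<open>B\<close> composed with \<open>z \<mapsto> z - (p \<bullet> z) x - (q \<bullet> z) y\<close>, a form that covers
  single reflections and products of two reflections.
\<close>

lemma trace_rank_two_update:
  fixes B :: "real ^ 'n ^ 'n"
  shows "(\<Sum>i\<in>UNIV. (B *v (axis i 1 - (p \<bullet> axis i 1) *\<^sub>R x - (q \<bullet> axis i 1) *\<^sub>R y)) $ i)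
       = (\<Sum>i\<in>UNIV. B $ i $ i) - p \<bullet> (B *v x) - q \<bullet> (B *v y)"
  by (simp add: matrix_vector_mult_diff_distrib matrix_vector_mult_scaleR inner_axis
      sum_subtractf matrix_vector_mult_basis column_def) (simp add: inner_vec_def)

lemma orthogonal_transformation_reflection:
  fixes v :: "'a::real_inner"
  shows "orthogonal_transformation (\<lambda>x. x - (2 * (x \<bullet> v) / (v \<bullet> v)) *\<^sub>R v)"
  unfolding orthogonal_transformation_def
proof (intro conjI allI)
  show "linear (\<lambda>x. x - (2 * (x \<bullet> v) / (v \<bullet> v)) *\<^sub>R v)"
    by (rule linearI) (simp_all add: inner_add_left algebra_simps add_divide_distrib)
  fix x y
  show "(x - (2 * (x \<bullet> v) / (v \<bullet> v)) *\<^sub>R v) \<bullet> (y - (2 * (y \<bullet> v) / (v \<bullet> v)) *\<^sub>R v) = x \<bullet> y"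
    by (cases "v = 0") (simp_all add: inner_diff_left inner_diff_right inner_commute field_simps)
qed

text \<open>
  Polar decomposition by optimisation: let \<open>Q\<close> maximise the trace of \<open>A Q\<close> over the compact set of
  orthogonal matrices and put \<open>B = A Q\<close>. Then \<open>B B\<^sup>T = A A\<^sup>T\<close>, and composing \<open>B\<close> with an orthogonal
  map cannot increase its trace. Taking the reflection in \<open>v\<close> shows that \<open>v \<bullet> B v \<ge> 0\<close>. Taking the
  product of the reflections in \<open>v\<close> and in the nearby vector \<open>v + e p\<close>, a small rotation, gives an
  inequality whose first-order term in \<open>e\<close> is \<open>v \<bullet> B p - p \<bullet> B v\<close>; it must vanish, so \<open>B\<close> is
  symmetric.
\<close>

lemma posdef_square_root_exists:
  fixes A :: "real ^ 'n ^ 'n"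
  assumes A: "invertible A"
  shows "\<exists>B. posdef B \<and> B ** B = A ** transpose A"
proof -
  let ?O = "{Q :: real ^ 'n ^ 'n. orthogonal_matrix Q}"
  have "continuous_on ?O (\<lambda>Q. trace (A ** Q))"
    unfolding trace_def matrix_matrix_mult_def by (simp, intro continuous_intros)
  then obtain Q where Q: "orthogonal_matrix Q" and max: "\<And>R. orthogonal_matrix R \<Longrightarrow> trace (A ** R) \<le> trace (A ** Q)"
    using continuous_attains_sup[OF compact_orthogonal_matrices] orthogonal_matrix_id by blast
  define B where "B = A ** Q"
  have maxB: "(\<Sum>i\<in>UNIV. (B *v f (axis i 1)) $ i) \<le> (\<Sum>i\<in>UNIV. B $ i $ i)"
    if f: "orthogonal_transformation f" for f :: "real ^ 'n \<Rightarrow> real ^ 'n"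
  proof -
    have R: "orthogonal_matrix (matrix f)" and lin: "linear f"
      using f by (simp_all add: orthogonal_transformation_matrix)
    have "(B ** matrix f) $ i $ i = (B *v f (axis i 1)) $ i" for i
    proof -
      have "f (axis i 1) = matrix f *v axis i 1" using matrix_works[of f "axis i 1"] lin
        by (simp add: linear_matrix_vector_mul_eq)
      then have "B *v f (axis i 1) = B *v (matrix f *v axis i 1)" by simp
      also have "\<dots> = (B ** matrix f) *v axis i 1" by (rule matrix_vector_mul_assoc)
      also have "\<dots> = column i (B ** matrix f)" by (rule matrix_vector_mult_basis)
      finally have "B *v f (axis i 1) = column i (B ** matrix f)" .
      then show ?thesis by (simp add: column_def)
    qed
    then have "(\<Sum>i\<in>UNIV. (B *v f (axis i 1)) $ i) = trace (A ** (Q ** matrix f))"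
      by (simp add: trace_def B_def matrix_mul_assoc)
    also have "\<dots> \<le> trace (A ** Q)" by (intro max orthogonal_matrix_mul Q R)
    finally show ?thesis by (simp add: trace_def B_def)
  qed
  have psd: "0 \<le> v \<bullet> (B *v v)" for v
  proof (cases "v = 0")
    case False
    have "(\<Sum>i\<in>UNIV. (B *v (axis i 1 - (2 * (axis i 1 \<bullet> v) / (v \<bullet> v)) *\<^sub>R v)) $ i) \<le> (\<Sum>i\<in>UNIV. B $ i $ i)"
      by (rule maxB[OF orthogonal_transformation_reflection])
    also have "(\<Sum>i\<in>UNIV. (B *v (axis i 1 - (2 * (axis i 1 \<bullet> v) / (v \<bullet> v)) *\<^sub>R v)) $ i)
        = (\<Sum>i\<in>UNIV. B $ i $ i) - ((2 / (v \<bullet> v)) *\<^sub>R v) \<bullet> (B *v v)"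
      using trace_rank_two_update[of B "(2 / (v \<bullet> v)) *\<^sub>R v" v 0 0] by (simp add: inner_commute)
    finally have "0 \<le> (2 / (v \<bullet> v)) * (v \<bullet> (B *v v))" by simp
    then show ?thesis using False mult_le_cancel_left_pos[of "2 / (v \<bullet> v)" 0 "v \<bullet> (B *v v)"] by simp
  qed simp
  have symij: "B $ i $ j = B $ j $ i" if "i \<noteq> j" for i j
  proof -
    define v p :: "real ^ 'n" where vp: "v = axis i 1" "p = axis j 1"
    have ortho: "v \<bullet> v = 1" "p \<bullet> p = 1" "v \<bullet> p = 0" "p \<bullet> v = 0"
      using that by (auto simp: vp inner_axis_axis)
    have "0 \<le> e * (v \<bullet> (B *v p) - p \<bullet> (B *v v)) + e\<^sup>2 * (p \<bullet> (B *v p) + v \<bullet> (B *v v))" for e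
    proof -
      define w where "w = v + e *\<^sub>R p"
      have ww: "w \<bullet> w = 1 + e\<^sup>2" "w \<bullet> v = 1" "v \<bullet> w = 1"
        using ortho by (simp_all add: w_def inner_add_left inner_add_right power2_eq_square)
      have pos: "w \<bullet> w > 0" using ww by (simp add: add_pos_nonneg)
      let ?H = "\<lambda>v x. x - (2 * (x \<bullet> v) / (v \<bullet> v)) *\<^sub>R v :: real ^ 'n"
      \<comment> \<open>The product of the two reflections, written in the form of \<open>trace_rank_two_update\<close>.\<close>
      define k where "k = 2 / (w \<bullet> w)"
      have "?H v (?H w x) = x - ((k *\<^sub>R w) \<bullet> x) *\<^sub>R w - ((2 *\<^sub>R v - (2 * k) *\<^sub>R w) \<bullet> x) *\<^sub>R v" for x
        using ortho ww by (simp add: k_def inner_diff_left inner_commute algebra_simps)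
      then have "(\<Sum>i\<in>UNIV. (B *v (?H v \<circ> ?H w) (axis i 1)) $ i)
          = (\<Sum>i\<in>UNIV. B $ i $ i) - (k *\<^sub>R w) \<bullet> (B *v w) - (2 *\<^sub>R v - (2 * k) *\<^sub>R w) \<bullet> (B *v v)"
        by (simp only: o_def trace_rank_two_update)
      moreover have "(\<Sum>i\<in>UNIV. (B *v (?H v \<circ> ?H w) (axis i 1)) $ i) \<le> (\<Sum>i\<in>UNIV. B $ i $ i)"
        by (intro maxB orthogonal_transformation_compose orthogonal_transformation_reflection)
      ultimately have "0 \<le> k * (w \<bullet> (B *v w)) + 2 * (v \<bullet> (B *v v)) - 2 * k * (w \<bullet> (B *v v))"
        by (simp add: inner_diff_left)
      then have "0 \<le> (k * (w \<bullet> (B *v w)) + 2 * (v \<bullet> (B *v v)) - 2 * k * (w \<bullet> (B *v v))) * ((w \<bullet> w) / 2)"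
        using pos by (intro mult_nonneg_nonneg) auto
      also have "\<dots> = (k * (w \<bullet> w) / 2) * (w \<bullet> (B *v w)) + (w \<bullet> w) * (v \<bullet> (B *v v)) - (k * (w \<bullet> w)) * (w \<bullet> (B *v v))"
        by (simp add: algebra_simps)
      also have "k * (w \<bullet> w) = 2" using pos by (simp add: k_def)
      finally have "0 \<le> w \<bullet> (B *v w) + (1 + e\<^sup>2) * (v \<bullet> (B *v v)) - 2 * (w \<bullet> (B *v v))"
        by (simp add: ww)
      also have "\<dots> = e * (v \<bullet> (B *v p) - p \<bullet> (B *v v)) + e\<^sup>2 * (p \<bullet> (B *v p) + v \<bullet> (B *v v))"
        by (simp add: w_def matrix_vector_right_distrib matrix_vector_mult_scaleR inner_add_left inner_add_right
            power2_eq_square algebra_simps)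
      finally show ?thesis .
    qed
    then have "v \<bullet> (B *v p) - p \<bullet> (B *v v) = 0" by (rule linear_coefficient_zero)
    then show ?thesis by (simp add: vp matrix_vector_mult_basis column_def inner_axis' inner_axis)
  qed
  have sym: "transpose B = B"
    unfolding vec_eq_iff transpose_def using symij by (metis vec_lambda_beta)
  have "invertible B"
    unfolding B_def using A Q by (intro invertible_mult) (auto simp: orthogonal_matrix_def invertible_def)
  with sym psd have "posdef B" by (intro posdefI_semidefinite_invertible)
  moreover have "B ** B = A ** transpose A"
  proof -
    have "B ** B = B ** transpose B" by (simp add: sym)
    also have "\<dots> = A ** (Q ** transpose Q) ** transpose A"
      by (simp add: B_def matrix_transpose_mul matrix_mul_assoc)
    also have "\<dots> = A ** transpose A" using Q by (simp add: orthogonal_matrix_def)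
    finally show ?thesis .
  qed
  ultimately show ?thesis by blast
qed

lemma matrix_sqrt_eq:
  assumes "posdef B" "B ** B = S" shows "matrix_sqrt S = B"
  unfolding matrix_sqrt_def using assms posdef_square_unique by (intro the_equality) auto

lemma matrix_mul_inv_vector:
  fixes A :: "real ^ 'n ^ 'n"
  assumes "invertible A" shows "A *v (matrix_inv A *v u) = u"
proof -
  have "A ** matrix_inv A = mat 1 \<and> matrix_inv A ** A = mat 1"
    unfolding matrix_inv_def using assms unfolding invertible_def by (rule someI_ex)
  then show ?thesis by (simp add: matrix_vector_mul_assoc)
qed

section \<open>Reduction to the standard Gaussian vector\<close>

text \<open>
  The rotation, under which the standard Gaussian law is invariant, turns the preimage of \<open>u\<close> into the
  direction of a coordinate vector. The number \<open>\<sigma>\<close> is the norm of \<open>C\<^sup>-\<^sup>1 u\<close> for every \<open>C\<close> with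
  \<open>C C\<^sup>T = S\<close>, since \<open>\<sigma>\<^sup>2 = u \<bullet> S\<^sup>-\<^sup>1 u\<close>; both \<open>A\<close> and the symmetric square root are such matrices.
  The last equation expresses the support function of the positivity set in the new coordinates.
\<close>

lemma gaussian_vector_whitening:
  fixes X :: "'s \<Rightarrow> real ^ 'n"
  assumes gv: "gaussian_vector M X" and zm: "mean_vector M X = 0"
    and cov: "covariance_matrix M X = S" and inv: "invertible S" and u: "u \<noteq> 0"
  obtains A :: "real ^ 'n ^ 'n" and b :: "real ^ 'n" and \<sigma> :: real where "b \<in> Basis" "invertible A" "0 < \<sigma>" "A *v (\<sigma> *\<^sub>R b) = u"
    "distr M borel X = distr standard_gaussian borel (\<lambda>z. A *v z)"
    "\<sigma> = norm (matrix_inv (matrix_sqrt S) *v u)"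
    "u \<bullet> (matrix_inv S *v u) = \<sigma>\<^sup>2"
    "\<And>z. (A *v z) \<bullet> (matrix_inv S *v u) = \<sigma> * (z \<bullet> b)"
proof -
  have X: "X \<in> borel_measurable M" using gv by (simp add: gaussian_vector_def)
  obtain m and A0 :: "real ^ 'n ^ 'n" where law0: "distr M borel X = distr standard_gaussian borel (\<lambda>z. m + A0 *v z)"
    using gv unfolding gaussian_vector_def by (elim conjE exE) (rule that)
  have m: "m = 0" and S: "S = A0 ** transpose A0"
    using gaussian_vector_moments[OF X law0] zm cov by auto
  have iA0: "invertible A0"
    using inv unfolding S invertible_right_inverse by (metis matrix_mul_assoc)
  obtain B where B: "posdef B" and BB: "B ** B = S"
    using posdef_square_root_exists[OF iA0] S by auto
  have Bs: "matrix_sqrt S = B" using B BB by (rule matrix_sqrt_eq)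
  define v where "v = matrix_inv S *v u"
  define y where "y = matrix_inv B *v u"
  define q where "q = matrix_inv A0 *v u"
  have Sv: "S *v v = u" unfolding v_def by (rule matrix_mul_inv_vector[OF inv])
  have By: "B *v y = u" unfolding y_def by (rule matrix_mul_inv_vector[OF posdef_invertible[OF B]])
  have Aq: "A0 *v q = u" unfolding q_def by (rule matrix_mul_inv_vector[OF iA0])
  have injm: "x = y" if "invertible C" "C *v x = C *v y" for C :: "real ^ 'n ^ 'n" and x y
    using that by (metis invertible_left_inverse matrix_vector_mul_assoc matrix_vector_mul_lid)
  have "B *v (B *v v) = B *v y" using Sv By by (simp add: matrix_vector_mul_assoc BB)
  then have Bv: "B *v v = y" using injm[OF posdef_invertible[OF B]] by blast
  have uv: "u \<bullet> v = y \<bullet> y"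
    using symmetric_matrix_inner[of B y v] B By Bv by (simp add: posdef_def)
  have "A0 *v (transpose A0 *v v) = A0 *v q" using Sv Aq by (simp only: matrix_vector_mul_assoc S)
  then have Av: "transpose A0 *v v = q" using injm[OF iA0] by blast
  have adj: "(A0 *v z) \<bullet> v = z \<bullet> q" for z
    using dot_lmul_matrix[of v A0 z] Av by (simp add: inner_commute)
  have uq: "u \<bullet> v = q \<bullet> q" using adj[of q] Aq by simp
  define \<sigma> where "\<sigma> = norm y"
  have sq: "\<sigma>\<^sup>2 = u \<bullet> v" "norm q = \<sigma>"
    using uv uq by (simp_all add: \<sigma>_def power2_norm_eq_inner norm_eq_sqrt_inner)
  have "q \<noteq> 0" using Aq u by auto
  then have \<sigma>: "0 < \<sigma>" using sq(2) by auto
  obtain k :: 'n where True by simp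
  define b :: "real ^ 'n" where "b = axis k 1"
  have b: "b \<in> Basis" "norm b = 1" by (simp_all add: b_def)
  have "norm ((1 / \<sigma>) *\<^sub>R q) = 1" using \<sigma> sq(2) by simp
  then obtain f where f: "orthogonal_transformation f" and fb: "f b = (1 / \<sigma>) *\<^sub>R q"
    using orthogonal_transformation_exists_1[OF b(2)] by metis
  define Q where "Q = matrix f"
  have lin: "linear f" and oQ: "orthogonal_matrix Q"
    using f by (simp_all add: orthogonal_transformation_matrix Q_def)
  have Qf: "Q *v z = f z" for z unfolding Q_def using lin
    by (intro matrix_works) (simp add: linear_matrix_vector_mul_eq)
  define A where "A = A0 ** Q"
  have Az: "A *v z = A0 *v f z" for z by (simp add: A_def Qf[symmetric] matrix_vector_mul_assoc)
  have [measurable]: "(*v) C \<in> borel_measurable borel" for C :: "real ^ 'n ^ 'n"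
    by (intro borel_measurable_continuous_onI linear_continuous_on matrix_vector_mul_bounded_linear)
  have [measurable]: "f \<in> borel_measurable borel"
    by (intro borel_measurable_continuous_onI linear_continuous_on linear_conv_bounded_linear[THEN iffD1] lin)
  show ?thesis
  proof (rule that)
    show "b \<in> Basis" by fact
    show "invertible A" unfolding A_def
      using iA0 oQ by (intro invertible_mult) (auto simp: orthogonal_matrix_def invertible_def)
    show "0 < \<sigma>" by fact
    show "A *v (\<sigma> *\<^sub>R b) = u" using \<sigma> by (simp add: Az linear_scale[OF lin] fb Aq)
    have "distr M borel X = distr standard_gaussian borel ((*v) A0)" using law0 by (simp add: m)
    also have "\<dots> = distr (distr standard_gaussian borel f) borel ((*v) A0)"
      by (simp add: standard_gaussian_rotation_invariant[OF f])
    also have "\<dots> = distr standard_gaussian borel ((*v) A0 \<circ> f)" by (rule distr_distr) measurable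
    also have "(*v) A0 \<circ> f = (\<lambda>z. A *v z)" by (simp add: fun_eq_iff Az)
    finally show "distr M borel X = distr standard_gaussian borel (\<lambda>z. A *v z)" .
    show "\<sigma> = norm (matrix_inv (matrix_sqrt S) *v u)" by (simp add: \<sigma>_def y_def Bs)
    show "u \<bullet> (matrix_inv S *v u) = \<sigma>\<^sup>2" using sq by (simp add: v_def)
    show "(A *v z) \<bullet> (matrix_inv S *v u) = \<sigma> * (z \<bullet> b)" for z
    proof -
      have "(A *v z) \<bullet> v = f z \<bullet> q" by (simp add: Az adj)
      also have "q = \<sigma> *\<^sub>R f b" using \<sigma> by (simp add: fb)
      also have "f z \<bullet> (\<sigma> *\<^sub>R f b) = \<sigma> * (z \<bullet> b)" using f by (simp add: orthogonal_transformation_def)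
      finally show ?thesis by (simp add: v_def)
    qed
  qed
qed

theorem theorem2p1:
  fixes M :: "'s measure"
    and X :: "'s \<Rightarrow> real ^ 'n"
    and S :: "real ^ 'n ^ 'n"
    and w :: "real ^ 'n \<Rightarrow> real"
    and u :: "real ^ 'n"
    and t :: real
  assumes gaussian: "gaussian_vector M X"
    and zero_mean: "mean_vector M X = 0"
    and covariance: "covariance_matrix M X = S"
    and nonsingular: "invertible S"
    and w_nonneg: "\<forall>x. 0 \<le> w x"
    and w_even: "even_fun w"
    and w_unimodal: "unimodal w"
    and w_pos: "expect M (\<lambda>\<omega>. w (X \<omega>)) > 0"
    and u_unit: "norm u = 1"
    and t_nonneg: "0 \<le> t"
  shows "0 \<le> a_coeff S w u
    \<and> exp (- (t\<^sup>2 * (u \<bullet> (matrix_inv S *v u))) / 2)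
        = r (t * norm (matrix_inv (matrix_sqrt S) *v u)) 0
    \<and> r (t * norm (matrix_inv (matrix_sqrt S) *v u)) 0
        \<le> expect M (\<lambda>\<omega>. w (X \<omega> - t *\<^sub>R u)) / expect M (\<lambda>\<omega>. w (X \<omega>))
    \<and> expect M (\<lambda>\<omega>. w (X \<omega> - t *\<^sub>R u)) / expect M (\<lambda>\<omega>. w (X \<omega>))
        \<le> r (t * norm (matrix_inv (matrix_sqrt S) *v u)) (a_coeff S w u)
    \<and> r (t * norm (matrix_inv (matrix_sqrt S) *v u)) (a_coeff S w u) \<le> 1"
proof -
  have M: "prob_space M" and X [measurable]: "X \<in> borel_measurable M"
    using gaussian by (auto simp: gaussian_vector_def)
  have "u \<noteq> 0" using u_unit by auto
  then obtain A :: "real ^ 'n ^ 'n" and b :: "real ^ 'n" and \<sigma> :: real where b: "b \<in> Basis"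
    and iA: "invertible A" and \<sigma>: "0 < \<sigma>" and Ab: "A *v (\<sigma> *\<^sub>R b) = u"
    and lawX: "distr M borel X = distr standard_gaussian borel (\<lambda>z. A *v z)"
    and \<sigma>_eq: "\<sigma> = norm (matrix_inv (matrix_sqrt S) *v u)"
    and quad: "u \<bullet> (matrix_inv S *v u) = \<sigma>\<^sup>2"
    and lin: "\<And>z. (A *v z) \<bullet> (matrix_inv S *v u) = \<sigma> * (z \<bullet> b)"
    using gaussian_vector_whitening[OF gaussian zero_mean covariance nonsingular] by metis
  obtain A' :: "real ^ 'n ^ 'n" where A': "A ** A' = mat 1" "A' ** A = mat 1"
    using iA by (auto simp: invertible_def)
  have [measurable]: "(*v) C \<in> borel_measurable borel" for C :: "real ^ 'n ^ 'n"
    by (intro borel_measurable_continuous_onI linear_continuous_on matrix_vector_mul_bounded_linear)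
  define Y where "Y = (\<lambda>\<omega>. A' *v X \<omega>)"
  define F where "F = (\<lambda>z. w (A *v z))"
  define c where "c = t * \<sigma>"
  have c: "0 \<le> c" using t_nonneg \<sigma> by (simp add: c_def)
  have XY: "X \<omega> = A *v Y \<omega>" for \<omega> by (simp add: Y_def matrix_vector_mul_assoc A')
  have Y [measurable]: "Y \<in> borel_measurable M" unfolding Y_def by measurable
  have lawY: "distr M borel Y = standard_gaussian"
  proof -
    have "distr M borel Y = distr (distr M borel X) borel ((*v) A')"
      by (subst distr_distr) (auto simp: Y_def comp_def)
    also have "\<dots> = distr standard_gaussian borel (\<lambda>z. A' *v (A *v z))"
      unfolding lawX by (subst distr_distr) (auto simp: comp_def)
    also have "\<dots> = standard_gaussian"
      by (simp add: matrix_vector_mul_assoc A' distr_id2)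
    finally show ?thesis .
  qed
  have nn: "0 \<le> F z" for z using w_nonneg by (simp add: F_def)
  have ev: "even_fun F" using w_even by (simp add: even_fun_def F_def linear_neg[OF matrix_vector_mul_linear])
  have uni: "unimodal F"
    unfolding unimodal_def
  proof
    fix s
    have "{z. F z > s} = (*v) A -` {x. w x > s}" by (auto simp: F_def)
    moreover have "convex ((*v) A -` {x. w x > s})"
      using w_unimodal by (intro convex_linear_vimage matrix_vector_mul_linear) (simp add: unimodal_def)
    ultimately show "convex {z. F z > s}" by (simp only:)
  qed
  have wF: "w (X \<omega> - t *\<^sub>R u) = F (Y \<omega> - c *\<^sub>R b)" "w (X \<omega>) = F (Y \<omega> - 0)" for \<omega>
  proof -
    have "A *v (c *\<^sub>R b) = t *\<^sub>R u" using Ab by (simp add: c_def matrix_vector_mult_scaleR flip: scaleR_scaleR)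
    then show "w (X \<omega> - t *\<^sub>R u) = F (Y \<omega> - c *\<^sub>R b)" "w (X \<omega>) = F (Y \<omega> - 0)"
      by (simp_all add: F_def XY matrix_vector_mult_diff_distrib)
  qed
  define E where "E = (\<lambda>v. expect M (\<lambda>\<omega>. F (Y \<omega> - v)))"
  have "expect M (\<lambda>\<omega>. F (Y \<omega> - v)) = E v" for v by (simp add: E_def)
  note shift = gaussian_shift_even_unimodal[OF M Y lawY nn ev uni b c, unfolded this]
  have E0: "0 < E 0" using w_pos by (simp add: wF E_def)
  define a where "a = a_coeff S w u"
  \<comment> \<open>In the coordinates of \<open>Y\<close>, \<open>a\<close> is half the width of the smallest slab containing the positivity set.\<close>
  have a_ge: "ereal (z \<bullet> b) \<le> a" if "0 < F z" for z
  proof -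
    have "ereal ((A *v z) \<bullet> (matrix_inv S *v u)) \<le> support_function (positivity_set w) (matrix_inv S *v u)"
      unfolding support_function_def
      using that by (intro SUP_upper) (simp add: positivity_set_def F_def)
    then have "ereal (\<sigma> * (z \<bullet> b)) / ereal \<sigma> \<le> a"
      unfolding a_def a_coeff_def \<sigma>_eq[symmetric] lin using \<sigma> by (intro ereal_divide_right_mono) auto
    then show ?thesis using \<sigma> by simp
  qed
  have FJ: "\<bar>z \<bullet> b\<bar> \<le> \<alpha>" if "0 < F z" "a = ereal \<alpha>" for z \<alpha>
  proof -
    have "0 < F (- z)" using that ev by (simp add: even_fun_def)
    then show ?thesis using a_ge[of z] a_ge[of "- z"] that by (simp add: abs_le_iff)
  qed
  obtain z0 where z0: "0 < F z0" "z0 \<bullet> b \<noteq> 0" using shift(3)[OF E0] by blast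
  have "0 < F 0" using z0(1) even_unimodal_le_zero[OF ev uni, of z0] by simp
  then have a0: "0 \<le> a" using a_ge[of 0] by (simp add: zero_ereal_def)
  have lower: "r c 0 \<le> E (c *\<^sub>R b) / E 0"
    using shift(1) E0 by (simp add: r_def field_simps)
  have upper: "E (c *\<^sub>R b) / E 0 \<le> r c a \<and> r c a \<le> 1"
  proof (cases a)
    case PInf
    interpret prob_space gauss1 by (rule prob_space_gauss1)
    have "E (c *\<^sub>R b) \<le> E 0" using shift(2)[of UNIV] prob_space by simp
    then show ?thesis using PInf E0 by (simp add: r_def)
  next
    case (real \<alpha>)
    \<comment> \<open>Not zero, because \<open>F\<close> does not live on a hyperplane; so the middle clause of \<open>r\<close> applies.\<close>
    have "0 < \<alpha>" using FJ[OF z0(1) real] z0(2) by auto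
    let ?m = "measure gauss1 {- \<alpha>..\<alpha>}" and ?m' = "measure gauss1 {s. s - c \<in> {- \<alpha>..\<alpha>}}"
    have m: "0 < ?m" by (rule measure_gauss1_interval_pos) fact
    have "E (c *\<^sub>R b) * ?m \<le> E 0 * ?m'"
      using FJ[OF _ real] by (intro shift(2)) (auto simp: abs_le_iff minus_le_iff)
    then have "E (c *\<^sub>R b) / E 0 \<le> ?m' / ?m" using E0 m by (simp add: field_simps)
    moreover have "?m' / ?m \<le> 1" using measure_gauss1_shift_le[OF c, of \<alpha>] m by simp
    moreover have "r c a = ?m' / ?m"
    proof -
      have "{s. s - c \<in> {- \<alpha>..\<alpha>}} = {c - \<alpha>..c + \<alpha>}" by auto
      then show ?thesis using \<open>0 < \<alpha>\<close> real by (simp add: r_def measure_gauss1_interval)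
    qed
    ultimately show ?thesis by simp
  next
    case MInf
    then show ?thesis using a0 by simp
  qed
  have "exp (- (t\<^sup>2 * (u \<bullet> (matrix_inv S *v u))) / 2) = r c 0"
    by (simp add: r_def quad c_def power_mult_distrib)
  then show ?thesis
    using a0 lower upper by (simp add: wF E_def a_def c_def \<sigma>_eq)
qed

end
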